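(* Let $m\ge 1$ and let $F(s),E(s)\in\mathbb{R}[s]^{m\times m}$ be polynomial matrices satisfying $$F(-s)E^\top(s)+E(-s)F^\top(s)=0\quad\text{and}\quad \operatorname{rank}\begin{bmatrix}F(-s)&E(-s)\end{bmatrix}=m\qquad\text{for all } s\in\mathbb{C}.$$ Consider a minimal factorization $$F(\zeta)E^\top(\eta)+E(\zeta)F^\top(\eta)=(\zeta+\eta)\,\Pi(\zeta,\eta),\qquad \Pi(\zeta,\eta)=Z^\top(\zeta)\,\Sigma\, Z(\eta),$$ with $Z(s)\in\mathbb{R}[s]^{n\times m}$ and $\Sigma\in\mathbb{R}^{n\times n}$ invertible and symmetric, together with the boundary map defined by $$Z(\tfrac{d}{dz})\ell(z)=b(z),\qquad \begin{bmatrix}f(z)\\ e(z)\end{bmatrix}=\begin{bmatrix}F^\top(\frac{d}{dz})\\ E^\top(\frac{d}{dz})\end{bmatrix}\ell(z),$$ where $\ell(z)\in\mathbb{R}^m$ is a vector of latent variables. Then for any $\alpha,\beta\in\mathbb{R}$ with $\alpha<\beta$, the space of all $f(z),e(z)$ ($z\in[\alpha,\beta]$), $b(\alpha),b(\beta)$ which are solutions of $$F(\tfrac{d}{dz})f(z)+E(\tfrac{d}{dz})e(z)=0,\qquad z\in[\alpha,\beta],$$ $$\begin{bmatrix}f(\alpha)\\ e(\alpha)\end{bmatrix}=\begin{bmatrix}F^\top(\frac{d}{dz})\\ E^\top(\frac{d}{dz})\end{bmatrix}\ell(\alpha),\qquad \begin{bmatrix}f(\beta)\\ e(\beta)\end{bmatrix}=\begin{bmatrix}F^\top(\frac{d}{dz})\\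 E^\top(\frac{d}{dz})\end{bmatrix}\ell(\beta),$$ $$b(\alpha)=Z(\tfrac{d}{dz})\,\ell(\alpha),\qquad b(\beta)=Z(\tfrac{d}{dz})\,\ell(\beta),$$ defines a Dirac structure with respect to the bilinear form $$\int_\alpha^\beta\left(e_1(z)^\top f_2(z)+e_2(z)^\top f_1(z)\right)dz-b_1(\beta)^\top\Sigma\, b_2(\beta)+b_1(\alpha)^\top\Sigma\, b_2(\alpha).$$
   Context: For a polynomial matrix $F(s)=\sum_k F_k s^k$, the differential operator $F(\frac{d}{dz})$ is $\sum_k F_k\frac{d^k}{dz^k}$, and $F^\top(s)$ denotes $F(s)^\top=\sum_k F_k^\top s^k$. The functions $f,e,\ell$ are smooth and $\mathbb{R}^m$-valued, and $b(\alpha),b(\beta)\in\mathbb{R}^n$. An expression such as $Z(\frac{d}{dz})\ell(\alpha)$ means the value at $z=\alpha$ of the function $Z(\frac{d}{dz})\ell$. Since $F(\zeta)E^\top(\eta)+E(\zeta)F^\top(\eta)$ vanishes when $\zeta+\eta=0$, it equals $(\zeta+\eta)\Pi(\zeta,\eta)$ for a symmetric two-variable polynomial matrix $\Pi(\zeta,\eta)=\sum_{k,l}\Pi_{k,l}\zeta^k\eta^l$ (symmetric means $\Pi(\zeta,\eta)=\Pi^\top(\eta,\zeta)$). The coefficient matrix $\widetilde{\Pi}$ of $\Pi$ is the infinite, finitely nonzero, block matrix with $(k,l)$-th block $\Pi_{k,l}$. A factorization $\Pi(\zeta,\eta)=Z^\top(\zeta)\Sigma Z(\eta)$, with $Z$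 having $n$ rows and $\Sigma=\Sigma^\top\in\mathbb{R}^{n\times n}$ invertible, is minimal if $n=\operatorname{rank}\widetilde{\Pi}$. A subspace $\mathcal{D}$ of a real vector space $V$ (here $V=C^\infty([\alpha,\beta],\mathbb{R}^m\times\mathbb{R}^m)\times\mathbb{R}^n\times\mathbb{R}^n$) with a symmetric bilinear form $\langle\langle\cdot,\cdot\rangle\rangle$ is a Dirac structure with respect to that form if $\mathcal{D}=\mathcal{D}^{\perp\!\!\!\perp}$, where $\mathcal{D}^{\perp\!\!\!\perp}=\{v\in V:\langle\langle v,w\rangle\rangle=0\text{ for all }w\in\mathcal{D}\}$.
   Formalization: The equation F(d/dz)f+E(d/dz)e=0 is replaced by E(-d/dz)f+F(-d/dz)e=0, since the printed one clashes with f=F^T(d/dz)ℓ, e=E^T(d/dz)ℓ (the claim fails for F=I, E=0); ℓ generates f, e on all of [α,β], not only at the endpoints. *)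

theory Defs
  imports
    "HOL-Analysis.Analysis"
    "HOL-Computational_Algebra.Polynomial"
    "HOL-Library.Function_Algebras"
begin

section \<open>Dirac structures\<close>

definition orth_companion :: "'v set \<Rightarrow> ('v \<Rightarrow> 'v \<Rightarrow> real) \<Rightarrow> 'v set \<Rightarrow> 'v set" where
  "orth_companion V form D = {v \<in> V. \<forall>w\<in>D. form v w = 0}"

text \<open>The ambient vector space is the subspace \<open>V\<close> of the type \<open>'v\<close>, with scalar
  multiplication \<open>smul\<close>.\<close>

definition dirac_structure ::
    "(real \<Rightarrow> 'v \<Rightarrow> 'v) \<Rightarrow> 'v set \<Rightarrow> ('v \<Rightarrow> 'v \<Rightarrow> real) \<Rightarrow> 'v::ab_group_add set \<Rightarrow> bool" where
  "dirac_structure smul V form D \<longleftrightarrow>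
     D \<subseteq> V \<and> module.subspace smul D \<and> D = orth_companion V form D"

section \<open>Polynomial matrices\<close>

text \<open>Square polynomial matrices have type \<open>real poly^'m^'m\<close>.  The number \<open>n\<close> of rows
  of \<open>Z\<close> may be zero (e.g. for constant \<open>F = mat 1\<close> and \<open>E = 0\<close>), so it is not encoded as a type:
  \<open>Z\<close> is given by its rows \<open>Z 0, ..., Z (n - 1)\<close>, the matrix \<open>\<Sigma>\<close> by its entries
  \<open>S p q\<close> with \<open>p, q < n\<close>, and a vector of \<open>\<real>\<^sup>n\<close> is a function on \<open>nat\<close> vanishing outside \<open>{..<n}\<close>.\<close>

definition pm_eval :: "real poly^'m^'k \<Rightarrow> complex \<Rightarrow> complex^'m^'k" where
  "pm_eval F s = (\<chi> i j. poly (map_poly of_real (F $ i $ j)) s)"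

definition hblock :: "'a^'m^'k \<Rightarrow> 'a^'l^'k \<Rightarrow> 'a^('m + 'l)^'k" where
  "hblock A B = (\<chi> i j. case j of Inl a \<Rightarrow> A $ i $ a | Inr b \<Rightarrow> B $ i $ b)"

definition pm_reflect :: "real poly^'m^'k \<Rightarrow> real poly^'m^'k" where
  "pm_reflect F = (\<chi> i j. pcompose (F $ i $ j) [:0, - 1:])"

text \<open>Two-variable polynomials are elements of \<open>real poly poly\<close>: the outer variable is \<open>\<zeta>\<close>
  and the inner one is \<open>\<eta>\<close>, so the coefficient of \<open>\<zeta>\<^sup>k \<eta>\<^sup>l\<close> in \<open>p\<close> is \<open>coeff (coeff p k) l\<close>.\<close>

definition in_zeta :: "real poly \<Rightarrow> real poly poly" where
  "in_zeta p = map_poly (\<lambda>c. [:c:]) p"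

definition in_eta :: "real poly \<Rightarrow> real poly poly" where
  "in_eta p = [:p:]"

definition zeta_plus_eta :: "real poly poly" where
  "zeta_plus_eta = in_zeta [:0, 1:] + in_eta [:0, 1:]"

definition pm_zeta :: "real poly^'m^'k \<Rightarrow> real poly poly^'m^'k" where
  "pm_zeta F = (\<chi> i j. in_zeta (F $ i $ j))"

definition pm_eta :: "real poly^'m^'k \<Rightarrow> real poly poly^'m^'k" where
  "pm_eta F = (\<chi> i j. in_eta (F $ i $ j))"

text \<open>\<open>\<Pi>(\<zeta>,\<eta>) = Z\<^sup>T(\<zeta>) \<Sigma> Z(\<eta>)\<close>\<close>

definition two_var_factor ::
    "nat \<Rightarrow> (nat \<Rightarrow> real poly^'m) \<Rightarrow> (nat \<Rightarrow> nat \<Rightarrow> real) \<Rightarrow> real poly poly^'m^'m" where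
  "two_var_factor n Z S =
     (\<chi> i j. \<Sum>p<n. \<Sum>q<n. in_zeta (Z p $ i) * [:[:S p q:]:] * in_eta (Z q $ j))"

definition sym_invertible :: "nat \<Rightarrow> (nat \<Rightarrow> nat \<Rightarrow> real) \<Rightarrow> bool" where
  "sym_invertible n S \<longleftrightarrow>
     (\<forall>p<n. \<forall>q<n. S p q = S q p) \<and>
     (\<exists>T. \<forall>p<n. \<forall>q<n.
        (\<Sum>r<n. S p r * T r q) = (if p = q then 1 else 0) \<and>
        (\<Sum>r<n. T p r * S r q) = (if p = q then 1 else 0))"

definition fun_scale :: "real \<Rightarrow> ('a \<Rightarrow> 'b::real_vector) \<Rightarrow> 'a \<Rightarrow> 'b" where
  "fun_scale c x = (\<lambda>t. c *\<^sub>R x t)"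

lemma vector_space_fun_scale: "vector_space (fun_scale :: real \<Rightarrow> ('a \<Rightarrow> 'b::real_vector) \<Rightarrow> _)"
  by standard (auto simp: fun_scale_def fun_eq_iff scaleR_add_left scaleR_add_right)

text \<open>The coefficient matrix has rows indexed by \<open>(k, i)\<close> and columns by \<open>(l, j)\<close>; its rank is the
  dimension of its row space, inside the space of all functions of \<open>(l, j)\<close>.\<close>

definition coeff_row :: "real poly poly^'m^'m \<Rightarrow> nat \<times> 'm \<Rightarrow> nat \<times> 'm \<Rightarrow> real" where
  "coeff_row P = (\<lambda>(k, i) (l, j). coeff (coeff (P $ i $ j) k) l)"

definition coeff_rank :: "real poly poly^'m^'m \<Rightarrow> nat" where
  "coeff_rank P = vector_space.dim fun_scale (range (coeff_row P))"

section \<open>Differential operators on \<open>[\<alpha>, \<beta>]\<close>\<close>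

text \<open>All derivatives are taken within the given set (one-sided at the endpoints of an interval).\<close>

primrec nth_deriv :: "real set \<Rightarrow> nat \<Rightarrow> (real \<Rightarrow> 'a::real_normed_vector) \<Rightarrow> real \<Rightarrow> 'a" where
  "nth_deriv I 0 w = w"
| "nth_deriv I (Suc k) w = (\<lambda>z. vector_derivative (nth_deriv I k w) (at z within I))"

definition smooth_within :: "real set \<Rightarrow> (real \<Rightarrow> 'a::real_normed_vector) \<Rightarrow> bool" where
  "smooth_within I w \<longleftrightarrow> (\<forall>k. nth_deriv I k w differentiable_on I)"

text \<open>\<open>p(d/dz) w = \<Sum>\<^sub>k p\<^sub>k w\<^sup>(\<^sup>k\<^sup>)\<close> for a row \<open>p(s) = \<Sum>\<^sub>k p\<^sub>k s\<^sup>k\<close>, summed entry by entry.\<close>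

definition row_op :: "real set \<Rightarrow> real poly^'m \<Rightarrow> (real \<Rightarrow> real^'m) \<Rightarrow> real \<Rightarrow> real" where
  "row_op I p w z = (\<Sum>j\<in>UNIV. \<Sum>k\<le>degree (p $ j). coeff (p $ j) k * nth_deriv I k w z $ j)"

definition diff_op :: "real set \<Rightarrow> real poly^'m^'k \<Rightarrow> (real \<Rightarrow> real^'m) \<Rightarrow> real \<Rightarrow> real^'k" where
  "diff_op I F w z = (\<chi> i. row_op I (F $ i) w z)"

definition boundary_op ::
    "real set \<Rightarrow> nat \<Rightarrow> (nat \<Rightarrow> real poly^'m) \<Rightarrow> (real \<Rightarrow> real^'m) \<Rightarrow> real \<Rightarrow> nat \<Rightarrow> real" where
  "boundary_op I n Z w z = (\<lambda>p. if p < n then row_op I (Z p) w z else 0)"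

section \<open>The space \<open>C\<^sup>\<infinity>([\<alpha>, \<beta>], \<real>\<^sup>m \<times> \<real>\<^sup>m) \<times> \<real>\<^sup>n \<times> \<real>\<^sup>n\<close>\<close>

type_synonym 'm ext_var =
  "(real \<Rightarrow> real^'m) \<times> (real \<Rightarrow> real^'m) \<times> (nat \<Rightarrow> real) \<times> (nat \<Rightarrow> real)"

definition ext_scale :: "real \<Rightarrow> ('m::finite) ext_var \<Rightarrow> 'm ext_var" where
  "ext_scale c = (\<lambda>(f, e, a, b). (fun_scale c f, fun_scale c e, fun_scale c a, fun_scale c b))"

lemma vector_space_ext_scale: "vector_space ext_scale"
  by standard
    (auto simp: ext_scale_def fun_scale_def fun_eq_iff scaleR_add_left scaleR_add_right distrib_left distrib_right)

text \<open>A function on \<open>[\<alpha>, \<beta>]\<close> is represented by its extension by zero, so that two functions agreeing on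
  \<open>[\<alpha>, \<beta>]\<close> are equal.  In \<open>(f, e, b\<^sub>\<alpha>, b\<^sub>\<beta>)\<close> the last two components are the boundary values
  at \<open>\<alpha>\<close> and \<open>\<beta>\<close>.\<close>

definition ext_space :: "real \<Rightarrow> real \<Rightarrow> nat \<Rightarrow> ('m::finite) ext_var set" where
  "ext_space \<alpha> \<beta> n = {(f, e, b\<^sub>\<alpha>, b\<^sub>\<beta>).
     smooth_within {\<alpha>..\<beta>} f \<and> smooth_within {\<alpha>..\<beta>} e \<and>
     (\<forall>z. z \<notin> {\<alpha>..\<beta>} \<longrightarrow> f z = 0 \<and> e z = 0) \<and>
     (\<forall>p\<ge>n. b\<^sub>\<alpha> p = 0 \<and> b\<^sub>\<beta> p = 0)}"

definition quad :: "nat \<Rightarrow> (nat \<Rightarrow> nat \<Rightarrow> real) \<Rightarrow> (nat \<Rightarrow> real) \<Rightarrow> (nat \<Rightarrow> real) \<Rightarrow> real" where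
  "quad n S x y = (\<Sum>p<n. \<Sum>q<n. x p * S p q * y q)"

definition ext_form ::
    "real \<Rightarrow> real \<Rightarrow> nat \<Rightarrow> (nat \<Rightarrow> nat \<Rightarrow> real) \<Rightarrow> ('m::finite) ext_var \<Rightarrow> 'm ext_var \<Rightarrow> real" where
  "ext_form \<alpha> \<beta> n S = (\<lambda>(f\<^sub>1, e\<^sub>1, a\<^sub>1, b\<^sub>1) (f\<^sub>2, e\<^sub>2, a\<^sub>2, b\<^sub>2).
     integral {\<alpha>..\<beta>} (\<lambda>z. e\<^sub>1 z \<bullet> f\<^sub>2 z + e\<^sub>2 z \<bullet> f\<^sub>1 z) - quad n S b\<^sub>1 b\<^sub>2 + quad n S a\<^sub>1 a\<^sub>2)"

text \<open>The latent variable \<open>\<ell>\<close> generates \<open>(f, e)\<close> on all of \<open>[\<alpha>, \<beta>]\<close>, in particular at both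
  endpoints.  The equation satisfied by \<open>(f, e)\<close> is \<open>E(-d/dz) f + F(-d/dz) e = 0\<close>: this is the
  kernel representation of the system with image representation
  \<open>f = F\<^sup>T(d/dz) \<ell>\<close>, \<open>e = E\<^sup>T(d/dz) \<ell>\<close>, since \<open>E(-s) F\<^sup>T(s) + F(-s) E\<^sup>T(s) = 0\<close>.  The equation
  \<open>F(d/dz) f + E(d/dz) e = 0\<close> would be incompatible with this image representation:
  for \<open>F = mat 1\<close> and \<open>E = 0\<close> it reads \<open>f = 0\<close>, whereas the image is given by \<open>e = 0\<close>.\<close>

definition boundary_system ::
    "real poly^'m^'m \<Rightarrow> real poly^'m^'m \<Rightarrow> nat \<Rightarrow> (nat \<Rightarrow> real poly^'m) \<Rightarrow> real \<Rightarrow> real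
      \<Rightarrow> ('m::finite) ext_var set" where
  "boundary_system F E n Z \<alpha> \<beta> = {(f, e, b\<^sub>\<alpha>, b\<^sub>\<beta>) \<in> ext_space \<alpha> \<beta> n.
     (\<forall>z\<in>{\<alpha>..\<beta>}. diff_op {\<alpha>..\<beta>} (pm_reflect E) f z + diff_op {\<alpha>..\<beta>} (pm_reflect F) e z = 0) \<and>
     (\<exists>l. smooth_within {\<alpha>..\<beta>} l \<and>
        (\<forall>z\<in>{\<alpha>..\<beta>}. f z = diff_op {\<alpha>..\<beta>} (transpose F) l z \<and>
                     e z = diff_op {\<alpha>..\<beta>} (transpose E) l z) \<and>
        b\<^sub>\<alpha> = boundary_op {\<alpha>..\<beta>} n Z l \<alpha> \<and>
        b\<^sub>\<beta> = boundary_op {\<alpha>..\<beta>} n Z l \<beta>)}"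

end

(* The boundary system is the image of the smooth latent variables l.  It is isotropic because
   d/dz (b1^T Sigma b2) = e1^T f2 + e2^T f1, which is the identity (zeta + eta) Pi = F E^T + E F^T read
   as an identity of bilinear differential operators.

   Conversely, let (f, e, x, y) be orthogonal to the system.  Pairing with latent variables that
   vanish to high order at both endpoints gives E(-d/dz) f + F(-d/dz) e = 0.  The rank condition makes
   [F E] right invertible over R[s], so that the kernel of [E(-s) F(-s)] is the image of [F^T; E^T] and
   (f, e) comes from some l.  Subtracting the element generated by l leaves boundary values that pair
   to zero with all Z(d/dz) l'; minimality makes the rows of Z linearly independent, and polynomial l'
   show that these boundary values vanish. *)

theory Submission
  imports Defs "HOL-Computational_Algebra.Fundamental_Theorem_Algebra"
begin

text \<open>Write R = [E(-s) F(-s)] and M = [F^T; E^T]. Exactness of the pair is used in the strong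
  form X R + M Y = 1 over the real polynomials. Applied to smooth functions, it produces l =
  Y(d/dz)(f, e) explicitly, so no differential equation has to be solved and l is smooth up to the
  endpoints. The identity rests on a count of sizes: with one-sided inverses of R and M, the matrix
  [X M] is square of size 2m, and over an integral domain a one-sided inverse of a square matrix is
  two-sided. A single orthogonality relation mixes the interior with both endpoints. Test functions
  that are flat at both ends isolate the interior. Once (f, e) is generated by some l, isotropy
  cancels the integral for every test function. The two endpoints are then told apart because a
  polynomial can have independent jets at two distinct points.\<close>

section \<open>Matrices over commutative rings\<close>

text \<open>The cofactors are determinants of \<open>A\<close> with one row replaced by a unit vector, so this is
  Laplace expansion.\<close>

lemma exists_adjugate:
  fixes A :: "'a::comm_ring_1^'n^'n"
  obtains C where "A ** C = mat (det A)"
proof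
  define C :: "'a^'n^'n" where "C = (\<chi> j i. det (\<chi> r. if r = i then axis j 1 else A $ r))"
  have expand: "(\<Sum>j\<in>UNIV. v $ j * C $ j $ i) = det (\<chi> r. if r = i then v else A $ r)" for v i
  proof -
    have v: "v = (\<Sum>j\<in>UNIV. v $ j *s axis j 1)"
      by (simp add: vec_eq_iff axis_def if_distrib cong: if_cong)
    have "det (\<chi> r. if r = i then v else A $ r)
        = (\<Sum>j\<in>UNIV. det (\<chi> r. if r = i then v $ j *s axis j 1 else A $ r))"
      by (subst v) (rule det_linear_row_sum, simp)
    then show ?thesis
      by (simp add: det_row_mul C_def)
  qed
  have "(A ** C) $ k $ i = mat (det A) $ k $ i" for k i
  proof -
    have "(A ** C) $ k $ i = det (\<chi> r. if r = i then A $ k else A $ r)"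
      by (simp add: matrix_matrix_mult_def expand)
    also have "\<dots> = (if k = i then det A else 0)"
    proof (cases "k = i")
      case True
      then have "(\<chi> r. if r = i then A $ k else A $ r) = A" by (auto simp: vec_eq_iff)
      with True show ?thesis by simp
    next
      case False
      then show ?thesis
        by (auto intro!: det_identical_rows[of k i] simp: row_def)
    qed
    finally show ?thesis by (simp add: mat_def)
  qed
  then show "A ** C = mat (det A)"
    by (simp add: vec_eq_iff)
qed

lemma mat_commute: "A ** mat c = mat c ** (A :: 'a::comm_semiring_1^'n^'m)"
  by (simp add: vec_eq_iff matrix_matrix_mult_def mat_def if_distrib if_distribR mult.commute cong: if_cong)

lemma mat_mult_component: "(mat c ** A) $ i $ j = c * (A $ i $ j)"
  for A :: "'a::comm_semiring_1^'n^'m"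
  by (simp add: matrix_matrix_mult_def mat_def if_distrib if_distribR cong: if_cong)

text \<open>Multiplying \<open>B ** C = mat (det B)\<close> by \<open>A\<close> from the left
  identifies \<open>C\<close> as \<open>A ** mat (det B)\<close>. Hence \<open>B ** A\<close> and
  \<open>mat 1\<close> agree after multiplication by the nonzero scalar \<open>det B\<close>, which
  cancels in an integral domain.\<close>

lemma matrix_left_right_inverse_idom:
  fixes A B :: "'a::idom^'n^'n"
  assumes "A ** B = mat 1"
  shows "B ** A = mat 1"
proof -
  obtain C where C: "B ** C = mat (det B)" by (rule exists_adjugate)
  have "det A * det B = 1" using assms by (metis det_I det_mul)
  then have nz: "det B \<noteq> 0" by auto
  have "A ** mat (det B) = A ** B ** C"
    by (simp add: C flip: matrix_mul_assoc)
  then have "A ** mat (det B) = C"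
    by (simp add: assms)
  then have "(B ** A) ** mat (det B) = mat 1 ** mat (det B)"
    using C by (simp flip: matrix_mul_assoc)
  then have "mat (det B) ** (B ** A) = mat (det B) ** mat 1"
    unfolding mat_commute[of "B ** A"] by simp
  then have "det B * (B ** A) $ i $ j = det B * (mat 1 :: 'a^'n^'n) $ i $ j" for i j
    by (metis mat_mult_component)
  with nz show ?thesis by (simp add: vec_eq_iff)
qed

lemma sum_UNIV_Plus:
  fixes g :: "'a::finite + 'b::finite \<Rightarrow> 'c::comm_monoid_add"
  shows "sum g UNIV = (\<Sum>a\<in>UNIV. g (Inl a)) + (\<Sum>b\<in>UNIV. g (Inr b))"
  by (subst UNIV_Plus_UNIV[symmetric], subst sum.Plus) simp_all

lemma matrix_diff_rdistrib: "(A - B) ** C = A ** C - B ** (C :: 'a::ring_1^'n^'m)"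
  by (simp add: vec_eq_iff matrix_matrix_mult_def left_diff_distrib sum_subtractf)

lemma matrix_mult_zero_right: "A ** 0 = (0 :: 'a::semiring_1^'n^'m)"
  by (simp add: vec_eq_iff matrix_matrix_mult_def)

text \<open>Stacking \<open>R\<close> on a suitable left inverse \<open>Y'\<close> of \<open>M\<close>
  gives a square matrix whose one-sided inverse \<open>[X M]\<close> is two-sided.\<close>

lemma exact_complement:
  fixes R :: "'a::idom^('m::finite + 'k::finite)^'m" and M :: "'a^'k^('m + 'k)"
  assumes RM: "R ** M = 0" and RX: "R ** X = mat 1" and YM: "Y ** M = mat 1"
  obtains Y' where "X ** R + M ** Y' = mat 1"
proof
  \<comment> \<open>The correction term dies on \<open>M\<close> because \<open>R ** M = 0\<close>,
    and it makes \<open>Y' ** X\<close> vanish because \<open>R ** X = mat 1\<close>.\<close>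
  define Y' where "Y' = Y - Y ** X ** R"
  have Y'M: "Y' ** M = mat 1"
    using RM YM by (simp add: Y'_def matrix_diff_rdistrib matrix_mult_zero_right flip: matrix_mul_assoc)
  have Y'X: "Y' ** X = 0"
    using RX by (simp add: Y'_def matrix_diff_rdistrib matrix_mult_zero_right flip: matrix_mul_assoc)
  define K :: "'a^('m + 'k)^('m + 'k)" where
    "K = (\<chi> i. case i of Inl a \<Rightarrow> R $ a | Inr b \<Rightarrow> Y' $ b)"
  define L :: "'a^('m + 'k)^('m + 'k)" where
    "L = (\<chi> i j. case j of Inl a \<Rightarrow> X $ i $ a | Inr b \<Rightarrow> M $ i $ b)"
  have "(K ** L) $ i $ j = mat 1 $ i $ j" for i j
  proof -
    have "(K ** L) $ i $ j = (case (i, j) of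
        (Inl a, Inl b) \<Rightarrow> (R ** X) $ a $ b | (Inl a, Inr b) \<Rightarrow> (R ** M) $ a $ b
      | (Inr a, Inl b) \<Rightarrow> (Y' ** X) $ a $ b | (Inr a, Inr b) \<Rightarrow> (Y' ** M) $ a $ b)"
      by (cases i; cases j) (simp_all add: K_def L_def matrix_matrix_mult_def)
    then show ?thesis
      by (cases i; cases j) (simp_all add: RM RX Y'M Y'X mat_def)
  qed
  then have "K ** L = mat 1" by (simp add: vec_eq_iff)
  then have LK: "L ** K = mat 1" by (rule matrix_left_right_inverse_idom)
  have "(X ** R + M ** Y') $ i $ j = (L ** K) $ i $ j" for i j
    by (simp add: K_def L_def matrix_matrix_mult_def sum_UNIV_Plus)
  with LK show "X ** R + M ** Y' = mat 1" by (simp add: vec_eq_iff)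
qed

text \<open>Independent rows make \<open>A\<close> right invertible, so its columns span. A basis
  chosen among the columns has \<open>CARD('m)\<close> members, and these form an invertible square
  submatrix.\<close>

lemma full_row_rank_minor:
  fixes A :: "'a::field^'n^'m"
  assumes "rank A = CARD('m)"
  obtains c :: "'m \<Rightarrow> 'n" where "det (\<chi> i j. A $ i $ c j) \<noteq> 0"
proof -
  have "vec.dim (rows A) = vec.dim (UNIV :: ('a^'n) set) \<or> True" by simp
  have fin: "finite (rows A)" by (simp add: rows_def full_SetCompr_eq)
  have rows: "rows A = range (\<lambda>i. row i A)" by (auto simp: rows_def)
  have cardr: "card (rows A) \<le> CARD('m)" by (simp add: rows card_image_le)
  have dimr: "vec.dim (rows A) = CARD('m)" using assms by (simp add: row_rank_def_gen)
  have "vec.dim (rows A) \<le> card (rows A)" by (rule vec.dim_le_card) (auto simp: fin vec.span_superset)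
  with cardr dimr have card_rows: "card (rows A) = CARD('m)" by simp
  \<comment> \<open>No row is repeated, so independence of the set \<open>rows A\<close> passes to
    the family of rows indexed by \<open>'m\<close>.\<close>
  then have inj: "inj (\<lambda>i. row i A)" by (simp add: rows eq_card_imp_inj_on)
  have indep: "vec.independent (rows A)"
    by (rule vec.card_le_dim_spanning[of _ "rows A"]) (auto simp: vec.span_superset fin dimr card_rows)
  have "\<forall>c. (\<Sum>i\<in>UNIV. c i *s row i A) = 0 \<longrightarrow> (\<forall>i. c i = 0)"
  proof (intro allI impI)
    fix c i assume c: "(\<Sum>i\<in>UNIV. c i *s row i A) = 0"
    have "(\<Sum>v\<in>rows A. c (the_inv (\<lambda>i. row i A) v) *s v) = 0"
      using c by (simp add: rows sum.reindex[OF inj] the_inv_f_f[OF inj])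
    then have "c (the_inv (\<lambda>i. row i A) (row i A)) = 0"
      using indep fin vec.independentD[of "rows A" "rows A" "\<lambda>v. c (the_inv (\<lambda>i. row i A) v)" "row i A"]
      by (auto simp: rows)
    then show "c i = 0" by (simp add: the_inv_f_f[OF inj])
  qed
  then have "\<exists>B. A ** B = mat 1" by (simp add: matrix_right_invertible_independent_rows)
  then have span: "vec.span (columns A) = UNIV"
    by (simp add: matrix_right_invertible_span_columns)
  obtain B where B: "B \<subseteq> columns A" "vec.independent B" "columns A \<subseteq> vec.span B"
      "card B = vec.dim (columns A)"
    by (rule vec.basis_exists)
  have "vec.dim (columns A) = CARD('m)"
    by (metis span vec.dim_span vec.dim_UNIV vec.dimension_def vec_dim_card)
  then have "card B = CARD('m)" using B by simp
  moreover have "finite B" using B(2) by (rule vec.finiteI_independent)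
  ultimately obtain h :: "'m \<Rightarrow> 'a^'m" where h: "bij_betw h UNIV B"
    by (metis bij_betw_iff_card finite)
  have "\<forall>j. \<exists>k. h j = column k A"
    using h B(1) by (auto simp: bij_betw_def columns_def)
  then obtain c where c: "\<And>j. h j = column (c j) A" by metis
  let ?D = "\<chi> i j. A $ i $ c j"
  have col: "column j ?D = h j" for j by (simp add: c column_def)
  have "\<forall>x. (\<Sum>j\<in>UNIV. x j *s column j ?D) = 0 \<longrightarrow> (\<forall>j. x j = 0)"
  proof (intro allI impI)
    fix x j assume x: "(\<Sum>j\<in>UNIV. x j *s column j ?D) = 0"
    have inj_h: "inj h" using h by (simp add: bij_betw_def)
    have Bh: "B = range h" using h by (simp add: bij_betw_def)
    have "(\<Sum>v\<in>B. x (the_inv h v) *s v) = 0"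
      using x by (simp add: Bh col sum.reindex[OF inj_h] the_inv_f_f[OF inj_h])
    then have "x (the_inv h (h j)) = 0"
      using B(2) \<open>finite B\<close> vec.independentD[of B B "\<lambda>v. x (the_inv h v)" "h j"]
      by (auto simp: Bh)
    then show "x j = 0" by (simp add: the_inv_f_f[OF inj_h])
  qed
  then have "\<exists>B. B ** ?D = mat 1" by (simp add: matrix_left_invertible_independent_columns)
  then have "det ?D \<noteq> 0" by (metis det_I det_mul mult_zero_right zero_neq_one)
  then show thesis by (rule that)
qed

section \<open>Right inverses of real polynomial matrices\<close>

abbreviation ceval :: "complex \<Rightarrow> real poly \<Rightarrow> complex" where
  "ceval s p \<equiv> poly (map_poly of_real p) s"

lemma ceval_pCons: "ceval s (pCons a p) = of_real a + s * ceval s p"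
  by (simp add: map_poly_pCons)

lemma ceval_add: "ceval s (p + q) = ceval s p + ceval s q"
proof -
  have "map_poly of_real (p + q) = map_poly of_real p + (map_poly of_real q :: complex poly)"
    by (simp add: poly_eq_iff coeff_map_poly)
  then show ?thesis by simp
qed

lemma ceval_smult: "ceval s (smult a p) = of_real a * ceval s p"
  by (induction p) (simp_all add: ceval_pCons algebra_simps)

lemma ceval_mult: "ceval s (p * q) = ceval s p * ceval s q"
  by (induction p) (simp_all add: ceval_pCons ceval_add ceval_smult algebra_simps)

lemma ceval_sum: "ceval s (\<Sum>x\<in>A. f x) = (\<Sum>x\<in>A. ceval s (f x))"
  by (induction A rule: infinite_finite_induct) (simp_all add: ceval_add)

lemma ceval_prod: "ceval s (\<Prod>x\<in>A. f x) = (\<Prod>x\<in>A. ceval s (f x))"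
  by (induction A rule: infinite_finite_induct) (simp_all add: ceval_mult map_poly_1)

lemma ceval_of_int: "ceval s (of_int k) = of_int k"
  by (simp add: of_int_poly map_poly_pCons)

lemma ceval_det: "ceval s (det A) = det (\<chi> i j. ceval s (A $ i $ j))"
  by (simp add: det_def ceval_sum ceval_mult ceval_prod ceval_of_int)

lemma ceval_of_real: "ceval (of_real x) p = of_real (poly p x)"
  by (induction p) (simp_all add: ceval_pCons)

text \<open>A nonunit is zero or has positive degree; in the second case the fundamental theorem of
  algebra applies. Real points would not do, as s^2 + 1 shows.\<close>

lemma ceval_common_root:
  assumes "\<not> is_unit d"
  obtains s where "\<And>q. d dvd q \<Longrightarrow> ceval s q = 0"
proof -
  have "\<exists>s. ceval s d = 0"
  proof (cases "d = 0")
    case False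
    with assms have "degree d \<noteq> 0" by (simp add: is_unit_iff_degree)
    then have "degree (map_poly of_real d :: complex poly) \<noteq> 0"
      by (simp add: degree_map_poly)
    then show ?thesis
      by (intro fundamental_theorem_of_algebra) (simp add: constant_degree)
  qed simp
  then obtain s where "ceval s d = 0" by blast
  then have "ceval s q = 0" if "d dvd q" for q
    using that by (auto simp: ceval_mult elim!: dvdE)
  then show thesis by (rule that)
qed

text \<open>Division by a nonzero element of least Euclidean size leaves a remainder that again lies
  in \<open>J\<close>, hence is zero.\<close>

lemma ideal_generator:
  fixes J :: "'a::euclidean_ring set"
  assumes "J \<noteq> {}"
    and diff: "\<And>p q. p \<in> J \<Longrightarrow> q \<in> J \<Longrightarrow> p - q \<in> J"
    and mult: "\<And>p q. p \<in> J \<Longrightarrow> q * p \<in> J"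
  obtains d where "d \<in> J" "\<And>p. p \<in> J \<Longrightarrow> d dvd p"
proof (cases "J \<subseteq> {0}")
  case True
  with assms(1) show thesis by (intro that[of 0]) auto
next
  case False
  then have ex: "\<exists>d. d \<in> J \<and> d \<noteq> 0" by auto
  obtain d where d: "d \<in> J" "d \<noteq> 0"
      and min: "\<And>r. r \<in> J \<Longrightarrow> r \<noteq> 0 \<Longrightarrow> euclidean_size d \<le> euclidean_size r"
    using exists_least_iff[of "\<lambda>k. \<exists>d. d \<in> J \<and> d \<noteq> 0 \<and> euclidean_size d = k"] ex
    by (metis not_less)
  have "d dvd p" if "p \<in> J" for p
  proof -
    have "p mod d = p - (p div d) * d" by (simp add: minus_div_mult_eq_mod)
    moreover have "p - (p div d) * d \<in> J" by (intro diff mult that d)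
    ultimately have "p mod d \<in> J" by simp
    then have "p mod d = 0"
      using min[of "p mod d"] mod_size_less[of d p] d by auto
    then show ?thesis by (simp add: dvd_eq_mod_eq_0)
  qed
  with d show thesis by (intro that) auto
qed

text \<open>The polynomials \<open>p\<close> such that \<open>p I\<close> is a right multiple of \<open>G\<close> form an ideal.  It contains all
  maximal minors of \<open>G\<close>, and these have no common complex zero.\<close>

lemma polynomial_right_inverse:
  fixes G :: "real poly^'n^'m"
  assumes rank: "\<And>s. rank (pm_eval G s) = CARD('m)"
  obtains H where "G ** H = mat 1"
proof -
  define J where "J = {p. \<exists>H. G ** H = mat p}"
  have minor: "det (\<chi> i j. G $ i $ c j) \<in> J" for c :: "'m \<Rightarrow> 'n"
  proof -
    let ?D = "\<chi> i j. G $ i $ c j"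
    obtain C where C: "?D ** C = mat (det ?D)" by (rule exists_adjugate)
    \<comment> \<open>Row \<open>l\<close> of the adjugate \<open>C\<close> is placed at position
      \<open>c l\<close>. Rows sent to the same position are added, so \<open>c\<close> may be any
      map.\<close>
    let ?H = "\<chi> k j. \<Sum>l\<in>UNIV. if c l = k then C $ l $ j else 0"
    have "(G ** ?H) $ i $ j = (?D ** C) $ i $ j" for i j
    proof -
      have "(G ** ?H) $ i $ j = (\<Sum>k\<in>UNIV. \<Sum>l\<in>UNIV. if c l = k then G $ i $ k * C $ l $ j else 0)"
        by (simp add: matrix_matrix_mult_def sum_distrib_left if_distrib cong: if_cong)
      also have "\<dots> = (\<Sum>l\<in>UNIV. \<Sum>k\<in>UNIV. if c l = k then G $ i $ k * C $ l $ j else 0)"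
        by (rule sum.swap)
      finally show ?thesis by (simp add: matrix_matrix_mult_def)
    qed
    then have "G ** ?H = mat (det ?D)" using C by (simp add: vec_eq_iff)
    then show ?thesis unfolding J_def by blast
  qed
  have "p - q \<in> J" if "p \<in> J" "q \<in> J" for p q
  proof -
    obtain H K where "G ** H = mat p" "G ** K = mat q" using \<open>p \<in> J\<close> \<open>q \<in> J\<close> by (auto simp: J_def)
    then have "G ** (H - K) = mat (p - q)"
      by (simp add: vec_eq_iff matrix_matrix_mult_def right_diff_distrib sum_subtractf mat_def)
    then show ?thesis by (auto simp: J_def)
  qed
  moreover have "q * p \<in> J" if "p \<in> J" for p q
  proof -
    obtain H where "G ** H = mat p" using \<open>p \<in> J\<close> by (auto simp: J_def)
    then have "G ** (H ** mat q) = mat p ** mat q" by (simp add: matrix_mul_assoc)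
    also have "\<dots> = mat (q * p)"
      by (simp add: vec_eq_iff mat_mult_component) (simp add: mat_def mult.commute)
    finally show ?thesis by (auto simp: J_def)
  qed
  ultimately obtain d where d: "d \<in> J" "\<And>p. p \<in> J \<Longrightarrow> d dvd p"
    using ideal_generator[of J] minor by blast
  have "is_unit d"
  proof (rule ccontr)
    assume "\<not> is_unit d"
    then obtain s where s: "\<And>q. d dvd q \<Longrightarrow> ceval s q = 0" using ceval_common_root by blast
    obtain c where "det (\<chi> i j. pm_eval G s $ i $ c j) \<noteq> 0"
      using rank by (rule full_row_rank_minor)
    then have "ceval s (det (\<chi> i j. G $ i $ c j)) \<noteq> 0" by (simp add: ceval_det pm_eval_def)
    with s d(2)[OF minor] show False by blast
  qed
  then obtain e where "1 = d * e" by (rule dvdE)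
  obtain H where "G ** H = mat d" using d(1) by (auto simp: J_def)
  then have "G ** (H ** mat e) = mat d ** mat e" by (simp add: matrix_mul_assoc)
  also have "\<dots> = mat 1"
    using \<open>1 = d * e\<close> by (simp add: vec_eq_iff mat_mult_component) (simp add: mat_def)
  finally show thesis by (rule that)
qed

text \<open>Here \<open>[F^T; E^T]\<close> stacks \<open>F^T\<close> on \<open>E^T\<close>; its left inverse is the transpose of a right inverse \<open>[A; B]\<close>
  of \<open>[F E]\<close>, and \<open>[E(-s) F(-s)]\<close> has the right inverse \<open>[B(-s); A(-s)]\<close>.\<close>

lemma kernel_image_identity:
  fixes F E :: "real poly^'m^'m"
  assumes skew: "\<And>s::complex. pm_eval F (- s) ** transpose (pm_eval E s)
             + pm_eval E (- s) ** transpose (pm_eval F s) = 0"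
    and rank: "\<And>s::complex. rank (hblock (pm_eval F (- s)) (pm_eval E (- s))) = CARD('m)"
  obtains X Y where
    "hblock (pm_reflect E) (pm_reflect F) ** transpose (hblock F E) = 0"
    "X ** hblock (pm_reflect E) (pm_reflect F) + transpose (hblock F E) ** Y = mat 1"
proof -
  let ?R = "hblock (pm_reflect E) (pm_reflect F)" and ?G = "hblock F E"
  have "pm_eval ?G s = hblock (pm_eval F s) (pm_eval E s)" for s
    by (simp add: vec_eq_iff pm_eval_def hblock_def split: sum.split)
  then have "rank (pm_eval ?G s) = CARD('m)" for s
    using rank[of "- s"] by simp
  then obtain H where H: "?G ** H = mat 1" by (rule polynomial_right_inverse)
  define X where "X = (\<chi> i j. pcompose (case i of Inl a \<Rightarrow> H $ Inr a $ j | Inr a \<Rightarrow> H $ Inl a $ j) [:0, - 1:])"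
  have "(?R ** transpose ?G) $ i $ j = 0" for i j
  proof -
    \<comment> \<open>At a real point \<open>x\<close> the entry is that of the skew identity at
      \<open>s = x\<close>, and a real polynomial vanishing at every real number is zero.\<close>
    have "poly ((?R ** transpose ?G) $ i $ j) x = 0" for x
    proof -
      have "poly ((?R ** transpose ?G) $ i $ j) x
        = Re ((pm_eval F (- of_real x) ** transpose (pm_eval E (of_real x))
             + pm_eval E (- of_real x) ** transpose (pm_eval F (of_real x))) $ i $ j)"
        using ceval_of_real[where x = "- x"]
        by (simp add: matrix_matrix_mult_def sum_UNIV_Plus hblock_def transpose_def pm_eval_def
            pm_reflect_def poly_sum poly_pcompose ceval_of_real flip: of_real_minus)
      then show ?thesis by (simp add: skew)
    qed
    then show ?thesis using poly_all_0_iff_0 by blast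
  qed
  then have RM: "?R ** transpose ?G = 0" by (simp add: vec_eq_iff)
  have "(?R ** X) $ i $ j = pcompose ((?G ** H) $ i $ j) [:0, - 1:]" for i j
    by (simp add: matrix_matrix_mult_def sum_UNIV_Plus hblock_def X_def pm_reflect_def
        pcompose_sum pcompose_add pcompose_mult add.commute)
  then have RX: "?R ** X = mat 1"
    unfolding H by (simp add: vec_eq_iff mat_def pcompose_1)
  have "transpose H ** transpose ?G = mat 1"
    using H by (metis matrix_transpose_mul transpose_mat)
  then obtain Y' where "X ** ?R + transpose ?G ** Y' = mat 1"
    using exact_complement[OF RM RX] by blast
  with RM show thesis by (rule that)
qed

section \<open>Minimality\<close>

lemma minimal_factor_rows_independent:
  fixes Z :: "nat \<Rightarrow> real poly^'m"
  assumes min: "n = coeff_rank (two_var_factor n Z S)"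
    and c: "\<And>j. (\<Sum>q<n. smult (c q) (Z q $ j)) = 0" and q: "q < n"
  shows "c q = 0"
proof (rule ccontr)
  assume nz: "c q \<noteq> 0"
  interpret V: vector_space "fun_scale :: real \<Rightarrow> (nat \<times> 'm \<Rightarrow> real) \<Rightarrow> _"
    by (rule vector_space_fun_scale)
  define row where "row p = (\<lambda>(l, j). coeff (Z p $ j) l)" for p
  let ?W = "row ` ({..<n} - {q})"
  have sum_apply: "(\<Sum>p\<in>A. g p) x = (\<Sum>p\<in>A. g p x)" for A and g :: "nat \<Rightarrow> nat \<times> 'm \<Rightarrow> real" and x
    by (induction A rule: infinite_finite_induct) simp_all
  have row_q: "row q = (\<Sum>p\<in>{..<n} - {q}. fun_scale (- c p / c q) (row p))"
  proof
    fix x :: "nat \<times> 'm"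
    obtain l j where x: "x = (l, j)" by (cases x)
    have "(\<Sum>p<n. c p * row p x) = 0"
      using arg_cong[OF c[of j], of "\<lambda>p. coeff p l"] by (simp add: coeff_sum row_def x)
    then have "c q * row q x + (\<Sum>p\<in>{..<n} - {q}. c p * row p x) = 0"
      using q by (simp add: sum.remove[of "{..<n}" q])
    then have "row q x = - (\<Sum>p\<in>{..<n} - {q}. c p * row p x) / c q"
      using nz by (simp add: field_simps)
    then show "row q x = (\<Sum>p\<in>{..<n} - {q}. fun_scale (- c p / c q) (row p)) x"
      by (simp add: sum_apply fun_scale_def sum_negf sum_divide_distrib)
  qed
  have row_in: "row p \<in> V.span ?W" if "p < n" for p
  proof (cases "p = q")
    case True
    show ?thesis unfolding True row_q
      by (intro V.span_sum V.span_scale V.span_base) auto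
  next
    case False
    with that show ?thesis by (intro V.span_base) auto
  qed
  have "coeff_row (two_var_factor n Z S) ki \<in> V.span ?W" for ki
  proof -
    obtain k i where ki: "ki = (k, i)" by (cases ki)
    have "coeff_row (two_var_factor n Z S) ki
        = (\<Sum>p<n. \<Sum>r<n. fun_scale (coeff (Z p $ i) k * S p r) (row r))"
    proof
      fix x :: "nat \<times> 'm"
      obtain l j where x: "x = (l, j)" by (cases x)
      have "coeff (coeff (in_zeta s * in_eta t) k) l = coeff s k * coeff t l" for s t
        by (simp add: in_zeta_def in_eta_def coeff_map_poly)
      then show "coeff_row (two_var_factor n Z S) ki x
          = (\<Sum>p<n. \<Sum>r<n. fun_scale (coeff (Z p $ i) k * S p r) (row r)) x"
        by (simp add: ki x coeff_row_def two_var_factor_def coeff_sum sum_apply fun_scale_def row_def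
            mult_ac)
    qed
    then show ?thesis
      by (auto intro!: V.span_sum V.span_scale row_in)
  qed
  then have "V.dim (range (coeff_row (two_var_factor n Z S))) \<le> card ?W"
    by (intro V.dim_le_card) auto
  \<comment> \<open>Here \<open>q < n\<close> makes \<open>n\<close> positive, so the truncated
    difference really is smaller than \<open>n\<close>.\<close>
  also have "\<dots> \<le> n - 1"
    using card_image_le[of "{..<n} - {q}" row] q by simp
  finally show False using min q by (simp add: coeff_rank_def)
qed

section \<open>Scalar differential operators on an interval\<close>

text \<open>One entry of \<open>row_op\<close>: on scalar functions, products of polynomials become
  compositions of operators.\<close>

definition scalar_op :: "real set \<Rightarrow> real poly \<Rightarrow> (real \<Rightarrow> real) \<Rightarrow> real \<Rightarrow> real" where
  "scalar_op I p u z = (\<Sum>k\<le>degree p. coeff p k * nth_deriv I k u z)"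

lemma scalar_op_bound:
  assumes "degree p \<le> N"
  shows "scalar_op I p u z = (\<Sum>k\<le>N. coeff p k * nth_deriv I k u z)"
  unfolding scalar_op_def using assms
  by (intro sum.mono_neutral_left) (auto simp: coeff_eq_0)

lemma nth_deriv_nth_deriv: "nth_deriv I k (nth_deriv I j u) = nth_deriv I (k + j) u"
  by (induction k) auto

lemma scalar_op_zero: "scalar_op I 0 u z = 0"
  by (simp add: scalar_op_def)

lemma scalar_op_pCons:
  "scalar_op I (pCons c p) u z = c * u z + scalar_op I p (nth_deriv I (Suc 0) u) z"
proof -
  have "degree (pCons c p) \<le> Suc (degree p)" by (simp add: degree_pCons_le)
  then show ?thesis
    by (simp add: scalar_op_bound[of "pCons c p" "Suc (degree p)"] scalar_op_def[of I p]
        sum.atMost_Suc_shift nth_deriv_nth_deriv del: sum.atMost_Suc nth_deriv.simps(2))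
qed

lemma scalar_op_add_poly: "scalar_op I (p + q) u z = scalar_op I p u z + scalar_op I q u z"
proof -
  have "degree (p + q) \<le> max (degree p) (degree q)" by (rule degree_add_le_max)
  then show ?thesis
    by (simp add: scalar_op_bound[of _ "max (degree p) (degree q)"] distrib_right sum.distrib)
qed

lemma scalar_op_smult: "scalar_op I (smult c p) u z = c * scalar_op I p u z"
  by (simp add: scalar_op_bound[of _ "degree p"] degree_smult_le sum_distrib_left mult.assoc)

lemma scalar_op_sum_poly: "scalar_op I (\<Sum>x\<in>A. p x) u z = (\<Sum>x\<in>A. scalar_op I (p x) u z)"
  by (induction A rule: infinite_finite_induct)
    (simp_all add: scalar_op_add_poly scalar_op_zero)

lemma scalar_op_one: "scalar_op I 1 u z = u z"
  by (simp add: scalar_op_def)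

section \<open>Product rule and orders of vanishing\<close>

text \<open>Pascal's rule, with \<open>x i\<close> and \<open>y i\<close> standing for the
  derivatives of order \<open>i\<close> of two factors: the left side is the termwise derivative of
  the Leibniz sum of order \<open>k\<close>.\<close>

lemma leibniz_step:
  fixes x y :: "nat \<Rightarrow> real"
  shows "(\<Sum>i\<le>k. real (k choose i) * (x i * y (Suc k - i) + x (Suc i) * y (k - i)))
       = (\<Sum>i\<le>Suc k. real (Suc k choose i) * (x i * y (Suc k - i)))"
proof -
  have "(\<Sum>i\<le>Suc k. real (Suc k choose i) * (x i * y (Suc k - i)))
      = x 0 * y (Suc k) + (\<Sum>i\<le>k. real (k choose Suc i) * (x (Suc i) * y (k - i)))
        + (\<Sum>i\<le>k. real (k choose i) * (x (Suc i) * y (k - i)))"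
    by (subst sum.atMost_Suc_shift) (simp add: sum.distrib algebra_simps)
  also have "x 0 * y (Suc k) + (\<Sum>i\<le>k. real (k choose Suc i) * (x (Suc i) * y (k - i)))
      = (\<Sum>i\<le>Suc k. real (k choose i) * (x i * y (Suc k - i)))"
    using sum.atMost_Suc_shift[of "\<lambda>i. real (k choose i) * (x i * y (Suc k - i))" k]
    by (simp del: sum.atMost_Suc)
  \<comment> \<open>The top term drops because \<open>k choose Suc k\<close> is zero.\<close>
  also have "\<dots> = (\<Sum>i\<le>k. real (k choose i) * (x i * y (Suc k - i)))" by simp
  finally show ?thesis by (simp add: sum.distrib distrib_left)
qed

lemma has_vector_derivative_vec_lambda:
  fixes u :: "real \<Rightarrow> 'j::finite \<Rightarrow> real"
  assumes "\<And>j. ((\<lambda>z. u z j) has_vector_derivative u' j) (at z within S)"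
  shows "((\<lambda>z. \<chi> j. u z j) has_vector_derivative (\<chi> j. u' j)) (at z within S)"
  using assms unfolding has_vector_derivative_def
  by (subst has_derivative_componentwise_within)
    (auto simp: Basis_vec_def inner_axis)

text \<open>One differentiation lowers the exponent of \<open>[:- c, 1:]\<close> by one and leaves a
  cofactor whose value at \<open>c\<close> is the old exponent times that of \<open>g\<close>; the
  induction collects these factors into \<open>fact K\<close>.\<close>

lemma poly_higher_pderiv_root:
  fixes g :: "'a::{idom,semiring_char_0} poly"
  assumes "k \<le> K"
  shows "poly ((pderiv ^^ k) ([:- c, 1:] ^ K * g)) c = (if k = K then fact K * poly g c else 0)"
  using assms
proof (induction K arbitrary: k g)
  case (Suc K)
  show ?case
  proof (cases k)
    case (Suc j)
    have "pderiv ([:- c, 1:] ^ Suc K * g)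
        = [:- c, 1:] ^ K * (of_nat (Suc K) * g + [:- c, 1:] * pderiv g)"
      by (simp only: pderiv_mult pderiv_power_Suc) (simp add: pderiv_pCons algebra_simps of_nat_poly)
    then have "(pderiv ^^ k) ([:- c, 1:] ^ Suc K * g)
        = (pderiv ^^ j) ([:- c, 1:] ^ K * (of_nat (Suc K) * g + [:- c, 1:] * pderiv g))"
      by (simp only: Suc funpow_Suc_right comp_apply)
    then show ?thesis
      using Suc.IH[of j "of_nat (Suc K) * g + [:- c, 1:] * pderiv g"] Suc.prems Suc
      by (simp del: power_Suc of_nat_Suc)
  qed simp
qed simp

section \<open>Two-variable polynomials as bilinear differential operators\<close>

text \<open>The variable \<zeta> differentiates \<open>u\<close> and \<eta> differentiates
  \<open>v\<close>, so that multiplication by \<zeta> + \<eta> becomes the product rule.\<close>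

definition bilinear_op ::
    "real set \<Rightarrow> real poly poly \<Rightarrow> (real \<Rightarrow> real) \<Rightarrow> (real \<Rightarrow> real) \<Rightarrow> real \<Rightarrow> real" where
  "bilinear_op I p u v z = (\<Sum>k\<le>degree p. nth_deriv I k u z * scalar_op I (coeff p k) v z)"

lemma bilinear_op_bound:
  assumes "degree p \<le> N"
  shows "bilinear_op I p u v z = (\<Sum>k\<le>N. nth_deriv I k u z * scalar_op I (coeff p k) v z)"
  unfolding bilinear_op_def using assms
  by (intro sum.mono_neutral_left) (auto simp: coeff_eq_0 scalar_op_zero)

lemma bilinear_op_zero: "bilinear_op I 0 u v z = 0"
  by (simp add: bilinear_op_def scalar_op_zero)

lemma bilinear_op_add: "bilinear_op I (p + q) u v z = bilinear_op I p u v z + bilinear_op I q u v z"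
proof -
  have "degree (p + q) \<le> max (degree p) (degree q)" by (rule degree_add_le_max)
  then show ?thesis
    by (simp add: bilinear_op_bound[of _ "max (degree p) (degree q)"] scalar_op_add_poly
        distrib_left sum.distrib)
qed

lemma bilinear_op_sum: "bilinear_op I (\<Sum>x\<in>A. p x) u v z = (\<Sum>x\<in>A. bilinear_op I (p x) u v z)"
  by (induction A rule: infinite_finite_induct) (simp_all add: bilinear_op_add bilinear_op_zero)

lemma bilinear_op_pCons:
  "bilinear_op I (pCons q p) u v z
     = u z * scalar_op I q v z + bilinear_op I p (nth_deriv I (Suc 0) u) v z"
proof -
  have "degree (pCons q p) \<le> Suc (degree p)" by (simp add: degree_pCons_le)
  then show ?thesis
    by (simp add: bilinear_op_bound[of "pCons q p" "Suc (degree p)"] bilinear_op_def[of I p]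
        sum.atMost_Suc_shift nth_deriv_nth_deriv del: sum.atMost_Suc nth_deriv.simps(2))
qed

lemma bilinear_op_in_zeta: "bilinear_op I (in_zeta p) u v z = scalar_op I p u z * v z"
proof (induction p arbitrary: u)
  case (pCons c p)
  have "in_zeta (pCons c p) = pCons [:c:] (in_zeta p)"
    by (simp add: in_zeta_def map_poly_pCons)
  then show ?case
    by (simp add: bilinear_op_pCons pCons.IH scalar_op_pCons scalar_op_zero algebra_simps
        del: nth_deriv.simps(2))
qed (simp add: in_zeta_def bilinear_op_zero scalar_op_zero)

section \<open>Latent variables\<close>

text \<open>The value zero outside \<open>I\<close> follows the representation used in
  \<open>ext_space\<close>, so generated signals can be compared as functions on the whole
  line.\<close>

definition latent_output :: "real set \<Rightarrow> real poly^'m^'m \<Rightarrow> (real \<Rightarrow> real^'m) \<Rightarrow> real \<Rightarrow> real^'m" where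
  "latent_output I A l z = (if z \<in> I then diff_op I (transpose A) l z else 0)"

text \<open>The index precedes the point, so that each component is a scalar function to which
  \<open>scalar_op\<close> applies; the sum type matches the columns of
  \<open>hblock\<close>.\<close>

definition vstack :: "(real \<Rightarrow> real^'m) \<Rightarrow> (real \<Rightarrow> real^'m) \<Rightarrow> 'm + 'm \<Rightarrow> real \<Rightarrow> real" where
  "vstack f e j z = (case j of Inl k \<Rightarrow> f z $ k | Inr k \<Rightarrow> e z $ k)"

lemma vstack_simps [simp]:
  "vstack f e (Inl k) = (\<lambda>z. f z $ k)" "vstack f e (Inr k) = (\<lambda>z. e z $ k)"
  by (simp_all add: vstack_def fun_eq_iff)

lemma ext_form_latent_output:
  "ext_form a b n S (f, e, x, y) (latent_output {a..b} F l, latent_output {a..b} E l, x', y')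
    = integral {a..b} (\<lambda>z. e z \<bullet> diff_op {a..b} (transpose F) l z + diff_op {a..b} (transpose E) l z \<bullet> f z)
      - quad n S y y' + quad n S x x'"
proof -
  have "integral {a..b} (\<lambda>z. e z \<bullet> latent_output {a..b} F l z + latent_output {a..b} E l z \<bullet> f z)
    = integral {a..b} (\<lambda>z. e z \<bullet> diff_op {a..b} (transpose F) l z + diff_op {a..b} (transpose E) l z \<bullet> f z)"
    by (intro integral_cong) (simp add: latent_output_def)
  then show ?thesis by (simp add: ext_form_def)
qed

section \<open>Calculus on an interval\<close>

context
  fixes a b :: real
  assumes ab: "a < b"
  notes nth_deriv.simps(2) [simp del]
begin

private abbreviation D where "D \<equiv> nth_deriv {a..b}"
private abbreviation smooth where "smooth \<equiv> smooth_within {a..b}"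
private abbreviation sop where "sop \<equiv> scalar_op {a..b}"
private abbreviation bop where "bop \<equiv> bilinear_op {a..b}"

lemma nth_deriv_has_vector_derivative:
  assumes "smooth u" "z \<in> {a..b}"
  shows "(D k u has_vector_derivative D (Suc k) u z) (at z within {a..b})"
  using assms unfolding smooth_within_def differentiable_on_def
  by (simp add: nth_deriv.simps(2) flip: vector_derivative_works)

text \<open>Exhibiting all candidate derivatives at once yields smoothness and the formula for every
  order, and serves each closure property below. Derivatives within \<open>{a..b}\<close> are
  unique, also at the endpoints, because \<open>a < b\<close>.\<close>

lemma derivative_sequence:
  assumes "\<And>z. z \<in> {a..b} \<Longrightarrow> g 0 z = u z"
    and "\<And>k z. z \<in> {a..b} \<Longrightarrow> (g k has_vector_derivative g (Suc k) z) (at z within {a..b})"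
  shows derivative_sequence_smooth: "smooth u"
    and "z \<in> {a..b} \<Longrightarrow> D k u z = g k z"
proof -
  have eq: "\<forall>z\<in>{a..b}. D k u z = g k z" for k
  proof (induction k)
    case 0
    then show ?case using assms(1) by simp
  next
    case (Suc k)
    show ?case
    proof
      fix z assume z: "z \<in> {a..b}"
      have "(D k u has_vector_derivative g (Suc k) z) (at z within {a..b})"
        using Suc by (intro has_vector_derivative_transform[OF z _ assms(2)[OF z]]) auto
      then show "D (Suc k) u z = g (Suc k) z"
        using vector_derivative_within_cbox[OF ab] z by (simp add: nth_deriv.simps(2))
    qed
  qed
  then show "z \<in> {a..b} \<Longrightarrow> D k u z = g k z" by simp
  have "(D k u has_vector_derivative g (Suc k) z) (at z within {a..b})" if z: "z \<in> {a..b}" for k z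
    using eq by (intro has_vector_derivative_transform[OF z _ assms(2)[OF z]]) auto
  then show "smooth u"
    unfolding smooth_within_def differentiable_on_def
    using differentiableI_vector by blast
qed

lemma smooth_cong:
  assumes "smooth u" "\<And>z. z \<in> {a..b} \<Longrightarrow> v z = u z"
  shows "smooth v"
  by (rule derivative_sequence_smooth[of "\<lambda>k. D k u"])
    (simp_all add: assms(2) nth_deriv_has_vector_derivative[OF assms(1)])

text \<open>Smoothness does not enter: functions that agree on the interval satisfy the same
  \<open>has_vector_derivative\<close> statements there, so the choice made by
  \<open>vector_derivative\<close> is the same even where no derivative exists.\<close>

lemma nth_deriv_cong:
  assumes "\<And>z. z \<in> {a..b} \<Longrightarrow> v z = u z" "z \<in> {a..b}"
  shows "D k v z = D k u z"
  using assms(2)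
proof (induction k arbitrary: z)
  case (Suc k)
  then have "(D k v has_vector_derivative d) (at z within {a..b})
      \<longleftrightarrow> (D k u has_vector_derivative d) (at z within {a..b})" for d
    by (metis has_vector_derivative_transform)
  then show ?case by (simp add: nth_deriv.simps(2) vector_derivative_def)
qed (simp add: assms(1))

lemma smooth_nth_deriv: "smooth u \<Longrightarrow> smooth (D k u)"
  by (simp add: smooth_within_def nth_deriv_nth_deriv)

lemma smooth_continuous: "smooth u \<Longrightarrow> continuous_on {a..b} u"
  using differentiable_imp_continuous_on unfolding smooth_within_def by (metis nth_deriv.simps(1))

lemma
  assumes "smooth w"
  shows smooth_component: "smooth (\<lambda>z. w z $ j)"
    and nth_deriv_component: "z \<in> {a..b} \<Longrightarrow> D k (\<lambda>z. w z $ j) z = D k w z $ j"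
proof -
  have "((\<lambda>z. D k w z $ j) has_vector_derivative D (Suc k) w z $ j) (at z within {a..b})"
    if "z \<in> {a..b}" for k z
    using nth_deriv_has_vector_derivative[OF assms that]
    by (rule bounded_linear.has_vector_derivative[OF bounded_linear_vec_nth])
  then show "smooth (\<lambda>z. w z $ j)" "z \<in> {a..b} \<Longrightarrow> D k (\<lambda>z. w z $ j) z = D k w z $ j"
    using derivative_sequence[of "\<lambda>k z. D k w z $ j" "\<lambda>z. w z $ j"] by simp_all
qed

lemma smooth_vec_lambda:
  assumes "\<And>j::'j::finite. smooth (u j :: real \<Rightarrow> real)"
  shows "smooth (\<lambda>z. \<chi> j. u j z)"
  by (rule derivative_sequence_smooth[of "\<lambda>k z. \<chi> j. D k (u j) z"])
    (simp_all add: has_vector_derivative_vec_lambda nth_deriv_has_vector_derivative[OF assms])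

lemma
  assumes "smooth u" "smooth v"
  shows smooth_add: "smooth (\<lambda>z. u z + v z)"
    and nth_deriv_add: "z \<in> {a..b} \<Longrightarrow> D k (\<lambda>z. u z + v z) z = D k u z + D k v z"
  using derivative_sequence[of "\<lambda>k z. D k u z + D k v z" "\<lambda>z. u z + v z"]
    has_vector_derivative_add[OF nth_deriv_has_vector_derivative[OF assms(1)]
      nth_deriv_has_vector_derivative[OF assms(2)]]
  by simp_all

lemma
  assumes "smooth u"
  shows smooth_scaleR: "smooth (\<lambda>z. c *\<^sub>R u z)"
    and nth_deriv_scaleR: "z \<in> {a..b} \<Longrightarrow> D k (\<lambda>z. c *\<^sub>R u z) z = c *\<^sub>R D k u z"
  using derivative_sequence[of "\<lambda>k z. c *\<^sub>R D k u z" "\<lambda>z. c *\<^sub>R u z"]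
    nth_deriv_has_vector_derivative[OF assms(1)]
  by (auto intro!: bounded_linear.has_vector_derivative[OF bounded_linear_scaleR_right]
     )

lemma
  shows smooth_zero: "smooth (\<lambda>z. 0)"
    and nth_deriv_zero: "z \<in> {a..b} \<Longrightarrow> D k (\<lambda>z. 0) z = 0"
  using derivative_sequence[of "\<lambda>k z. 0" "\<lambda>z. 0"] by simp_all

lemma
  assumes "\<And>x. x \<in> A \<Longrightarrow> smooth (u x)"
  shows smooth_sum: "smooth (\<lambda>z. \<Sum>x\<in>A. u x z)"
    and nth_deriv_sum: "z \<in> {a..b} \<Longrightarrow> D k (\<lambda>z. \<Sum>x\<in>A. u x z) z = (\<Sum>x\<in>A. D k (u x) z)"
proof -
  have "((\<lambda>z. \<Sum>x\<in>A. D k (u x) z) has_vector_derivative (\<Sum>x\<in>A. D (Suc k) (u x) z))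
      (at z within {a..b})" if "z \<in> {a..b}" for k z
    using that assms by (intro has_vector_derivative_sum nth_deriv_has_vector_derivative)
  then show "smooth (\<lambda>z. \<Sum>x\<in>A. u x z)"
    "z \<in> {a..b} \<Longrightarrow> D k (\<lambda>z. \<Sum>x\<in>A. u x z) z = (\<Sum>x\<in>A. D k (u x) z)"
    using derivative_sequence[of "\<lambda>k z. \<Sum>x\<in>A. D k (u x) z" "\<lambda>z. \<Sum>x\<in>A. u x z"] by simp_all
qed

section \<open>Constant coefficient operators on smooth functions\<close>

lemma
  assumes "smooth u"
  shows smooth_scalar_op: "smooth (sop p u)"
    and nth_deriv_scalar_op: "z \<in> {a..b} \<Longrightarrow> D k (sop p u) z = sop p (D k u) z"
proof -
  have "((\<lambda>z. \<Sum>i\<le>degree p. coeff p i * D (i + k) u z) has_vector_derivative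
      (\<Sum>i\<le>degree p. coeff p i * D (i + Suc k) u z)) (at z within {a..b})"
    if "z \<in> {a..b}" for k z
    using nth_deriv_has_vector_derivative[OF assms that]
    by (intro has_vector_derivative_sum bounded_linear.has_vector_derivative[OF bounded_linear_mult_right])
      (simp)
  then have "(sop p (D k u) has_vector_derivative sop p (D (Suc k) u) z) (at z within {a..b})"
    if "z \<in> {a..b}" for k z
    unfolding scalar_op_def nth_deriv_nth_deriv using that by blast
  then show "smooth (sop p u)" "z \<in> {a..b} \<Longrightarrow> D k (sop p u) z = sop p (D k u) z"
    using derivative_sequence[of "\<lambda>k. sop p (D k u)" "sop p u"] by simp_all
qed

lemma scalar_op_cong:
  assumes "\<And>z. z \<in> {a..b} \<Longrightarrow> v z = u z" "z \<in> {a..b}"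
  shows "sop p v z = sop p u z"
  using nth_deriv_cong[of v u] assms by (simp add: scalar_op_def)

lemma scalar_op_sum:
  assumes "\<And>x. x \<in> A \<Longrightarrow> smooth (u x)" "z \<in> {a..b}"
  shows "sop p (\<lambda>z. \<Sum>x\<in>A. u x z) z = (\<Sum>x\<in>A. sop p (u x) z)"
  using assms by (simp add: scalar_op_def nth_deriv_sum sum_distrib_left sum.swap[of _ A])

text \<open>Having constant coefficients, \<open>sop q\<close> commutes with differentiation of
  smooth functions, which is what the recursion over \<open>p\<close> uses.\<close>

lemma scalar_op_mult:
  assumes "smooth u" "z \<in> {a..b}"
  shows "sop (p * q) u z = sop p (sop q u) z"
  using assms(1)
proof (induction p arbitrary: u)
  case (pCons c p)
  have "sop (pCons c p * q) u z = c * sop q u z + sop p (sop q (D (Suc 0) u)) z"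
    using pCons.IH[OF smooth_nth_deriv[OF pCons.prems]]
    by (simp add: scalar_op_add_poly scalar_op_smult scalar_op_pCons)
  also have "sop p (sop q (D (Suc 0) u)) z = sop p (D (Suc 0) (sop q u)) z"
    using pCons.prems assms(2) by (intro scalar_op_cong) (simp_all add: nth_deriv_scalar_op)
  finally show ?case by (simp add: scalar_op_pCons)
qed (simp add: scalar_op_zero)

lemma matrix_op_mult:
  assumes "\<And>j. smooth (u j)" "z \<in> {a..b}"
  shows "(\<Sum>j\<in>UNIV. sop ((A ** B) $ i $ j) (u j) z)
       = (\<Sum>k\<in>UNIV. sop (A $ i $ k) (\<lambda>z. \<Sum>j\<in>UNIV. sop (B $ k $ j) (u j) z) z)"
proof -
  have "(\<Sum>j\<in>UNIV. sop ((A ** B) $ i $ j) (u j) z)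
      = (\<Sum>j\<in>UNIV. \<Sum>k\<in>UNIV. sop (A $ i $ k) (sop (B $ k $ j) (u j)) z)"
    using assms by (simp add: matrix_matrix_mult_def scalar_op_sum_poly scalar_op_mult)
  also have "\<dots> = (\<Sum>k\<in>UNIV. \<Sum>j\<in>UNIV. sop (A $ i $ k) (sop (B $ k $ j) (u j)) z)"
    by (rule sum.swap)
  finally show ?thesis
    using assms by (simp add: scalar_op_sum smooth_scalar_op)
qed

lemma row_op_eq:
  assumes "smooth w" "z \<in> {a..b}"
  shows "row_op {a..b} p w z = (\<Sum>j\<in>UNIV. sop (p $ j) (\<lambda>z. w z $ j) z)"
  using assms by (simp add: row_op_def scalar_op_def nth_deriv_component)

section \<open>Products and polynomials\<close>

lemma
  fixes u v :: "real \<Rightarrow> real"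
  assumes "smooth u" "smooth v"
  shows smooth_mult: "smooth (\<lambda>z. u z * v z)"
    and nth_deriv_mult: "z \<in> {a..b} \<Longrightarrow>
      D k (\<lambda>z. u z * v z) z = (\<Sum>i\<le>k. real (k choose i) * (D i u z * D (k - i) v z))"
proof -
  have "((\<lambda>z. \<Sum>i\<le>k. real (k choose i) * (D i u z * D (k - i) v z)) has_vector_derivative
      (\<Sum>i\<le>k. real (k choose i) * (D i u z * D (Suc k - i) v z + D (Suc i) u z * D (k - i) v z)))
      (at z within {a..b})"
    if "z \<in> {a..b}" for k z
    using nth_deriv_has_vector_derivative[OF assms(1) that]
      nth_deriv_has_vector_derivative[OF assms(2) that]
    by (intro has_vector_derivative_sum bounded_linear.has_vector_derivative[OF bounded_linear_mult_right]
        has_vector_derivative_mult) (auto simp: Suc_diff_le)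
  then have "((\<lambda>z. \<Sum>i\<le>k. real (k choose i) * (D i u z * D (k - i) v z)) has_vector_derivative
      (\<Sum>i\<le>Suc k. real (Suc k choose i) * (D i u z * D (Suc k - i) v z)))
      (at z within {a..b})"
    if "z \<in> {a..b}" for k z
    using that unfolding leibniz_step[of k "\<lambda>i. D i u z" "\<lambda>i. D i v z" for k z] by blast
  then show "smooth (\<lambda>z. u z * v z)" "z \<in> {a..b} \<Longrightarrow>
      D k (\<lambda>z. u z * v z) z = (\<Sum>i\<le>k. real (k choose i) * (D i u z * D (k - i) v z))"
    using derivative_sequence[of "\<lambda>k z. \<Sum>i\<le>k. real (k choose i) * (D i u z * D (k - i) v z)"
        "\<lambda>z. u z * v z"] by simp_all
qed

lemma
  shows smooth_poly: "smooth (poly p)"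
    and nth_deriv_poly: "z \<in> {a..b} \<Longrightarrow> D k (poly p) z = poly ((pderiv ^^ k) p) z"
proof -
  have "(poly q has_vector_derivative poly (pderiv q) z) (at z within {a..b})" for q z
    by (simp add: poly_DERIV has_field_derivative_at_within flip: has_real_derivative_iff_has_vector_derivative)
  then show "smooth (poly p)" "z \<in> {a..b} \<Longrightarrow> D k (poly p) z = poly ((pderiv ^^ k) p) z"
    using derivative_sequence[of "\<lambda>k. poly ((pderiv ^^ k) p)" "poly p"] by simp_all
qed

section \<open>Integration by parts and formal adjoints\<close>

lemma integral_by_parts:
  fixes u v :: "real \<Rightarrow> real"
  assumes "smooth u" "smooth v" "v a = 0" "v b = 0"
  shows "integral {a..b} (\<lambda>z. u z * D (Suc 0) v z) = - integral {a..b} (\<lambda>z. D (Suc 0) u z * v z)"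
proof -
  have cont: "continuous_on {a..b} (\<lambda>z. u z * D (Suc 0) v z)" "continuous_on {a..b} (\<lambda>z. D (Suc 0) u z * v z)"
    by (intro continuous_on_mult smooth_continuous smooth_nth_deriv assms)+
  have "((\<lambda>z. u z * v z) has_vector_derivative u z * D (Suc 0) v z + D (Suc 0) u z * v z) (at z within {a..b})"
    if "z \<in> {a..b}" for z
    using nth_deriv_has_vector_derivative[OF assms(1) that, of 0]
      nth_deriv_has_vector_derivative[OF assms(2) that, of 0]
    by (intro has_vector_derivative_mult) simp_all
  then have "((\<lambda>z. u z * D (Suc 0) v z + D (Suc 0) u z * v z) has_integral u b * v b - u a * v a) {a..b}"
    using ab by (intro fundamental_theorem_of_calculus) auto
  then have "integral {a..b} (\<lambda>z. u z * D (Suc 0) v z + D (Suc 0) u z * v z) = 0"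
    using assms(3,4) by (simp add: integral_unique)
  then show ?thesis
    using cont by (simp add: integral_add integrable_continuous_real)
qed

text \<open>Moving one factor s from \<open>v\<close> to \<open>u\<close> costs an integration by
  parts, hence one sign and one order of vanishing of \<open>v\<close>. The signs add up to the
  reflected polynomial, and \<open>N\<close> drops by one in each step.\<close>

lemma scalar_op_adjoint:
  assumes "smooth u" "smooth v" "degree p < N"
    and "\<And>k. k < N \<Longrightarrow> D k v a = 0" "\<And>k. k < N \<Longrightarrow> D k v b = 0"
  shows "integral {a..b} (\<lambda>z. u z * sop p v z)
       = integral {a..b} (\<lambda>z. sop (pcompose p [:0, - 1:]) u z * v z)"
  using assms
proof (induction p arbitrary: v N)
  case 0
  then show ?case by (simp add: scalar_op_zero)
next
  case (pCons c p)
  let ?q = "pcompose p [:0, - 1:]"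
  show ?case
  \<comment> \<open>For \<open>p = 0\<close> the bound \<open>N\<close> may be 1, which would leave
    no order of vanishing for the induction hypothesis.\<close>
  proof (cases "p = 0")
    case True
    then show ?thesis by (simp add: scalar_op_pCons scalar_op_zero mult.assoc mult.left_commute)
  next
    case False
    then obtain M where M: "N = Suc M" "degree p < M" using pCons.prems(3) by (cases N) auto
    have v: "v a = 0" "v b = 0" using pCons.prems(4)[of 0] pCons.prems(5)[of 0] M(1) by auto
    have van: "D k (D (Suc 0) v) a = 0" "D k (D (Suc 0) v) b = 0" if "k < M" for k
      using pCons.prems(4)[of "Suc k"] pCons.prems(5)[of "Suc k"] M(1) that
      by (simp_all add: nth_deriv_nth_deriv)
    have sm: "smooth (D (Suc 0) v)" "smooth (sop ?q u)" "smooth (D (Suc 0) (sop ?q u))"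
      "smooth (sop p (D (Suc 0) v))"
      using pCons.prems(1,2) by (simp_all only: smooth_nth_deriv smooth_scalar_op)
    note cont = pCons.prems(1,2)[THEN smooth_continuous] sm[THEN smooth_continuous]
    have "integral {a..b} (\<lambda>z. u z * sop (pCons c p) v z)
        = integral {a..b} (\<lambda>z. c * (u z * v z) + u z * sop p (D (Suc 0) v) z)"
      by (simp add: scalar_op_pCons algebra_simps)
    also have "\<dots> = integral {a..b} (\<lambda>z. c * (u z * v z)) + integral {a..b} (\<lambda>z. u z * sop p (D (Suc 0) v) z)"
      by (intro integral_add integrable_continuous_real continuous_intros cont)
    also have "integral {a..b} (\<lambda>z. u z * sop p (D (Suc 0) v) z) = integral {a..b} (\<lambda>z. sop ?q u z * D (Suc 0) v z)"
      using pCons.prems(1) sm(1) M(2) van by (rule pCons.IH)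
    also have "\<dots> = - integral {a..b} (\<lambda>z. D (Suc 0) (sop ?q u) z * v z)"
      using sm(2) pCons.prems(2) v by (rule integral_by_parts)
    also have "integral {a..b} (\<lambda>z. c * (u z * v z)) + - integral {a..b} (\<lambda>z. D (Suc 0) (sop ?q u) z * v z)
        = integral {a..b} (\<lambda>z. c * (u z * v z) - D (Suc 0) (sop ?q u) z * v z)"
      by (subst integral_diff) (auto intro!: integrable_continuous_real continuous_intros cont)
    also have "\<dots> = integral {a..b} (\<lambda>z. sop (pcompose (pCons c p) [:0, - 1:]) u z * v z)"
    proof (rule integral_cong)
      fix z assume z: "z \<in> {a..b}"
      have "pcompose (pCons c p) [:0, - 1:] = pCons c 0 + smult (- 1) (pCons 0 ?q)"
        by (simp add: pcompose_pCons)
      then have *: "sop (pcompose (pCons c p) [:0, - 1:]) u z = c * u z - sop ?q (D (Suc 0) u) z"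
        by (simp only: scalar_op_add_poly scalar_op_smult scalar_op_pCons scalar_op_zero) simp
      show "c * (u z * v z) - D (Suc 0) (sop ?q u) z * v z = sop (pcompose (pCons c p) [:0, - 1:]) u z * v z"
        unfolding * using pCons.prems(1) z by (simp add: nth_deriv_scalar_op left_diff_distrib)
    qed
    finally show ?thesis .
  qed
qed

section \<open>The power balance\<close>

lemma bilinear_op_smult:
  assumes "smooth v" "z \<in> {a..b}"
  shows "bop (smult q p) u v z = bop p u (sop q v) z"
proof -
  have "bop (smult q p) u v z = (\<Sum>k\<le>degree p. D k u z * sop (q * coeff p k) v z)"
    by (simp add: bilinear_op_bound[of _ "degree p"] degree_smult_le)
  also have "\<dots> = bop p u (sop q v) z"
    using assms by (simp add: bilinear_op_def scalar_op_mult mult.commute[of q])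
  finally show ?thesis .
qed

lemma bilinear_op_product:
  assumes "smooth v" "z \<in> {a..b}"
  shows "bop (in_zeta p * in_eta q) u v z = sop p u z * sop q v z"
  using assms by (simp add: in_eta_def bilinear_op_smult bilinear_op_in_zeta)

text \<open>The product rule: differentiating the left factor multiplies by \<zeta>, differentiating
  the right factor multiplies by \<eta>.\<close>

lemma bilinear_op_has_derivative:
  assumes "smooth u" "smooth v" "z \<in> {a..b}"
  shows "(bop p u v has_vector_derivative bop (zeta_plus_eta * p) u v z) (at z within {a..b})"
proof -
  let ?X = "[:0, 1:] :: real poly"
  have zpe: "zeta_plus_eta * p = pCons 0 p + smult ?X p"
    by (simp add: zeta_plus_eta_def in_zeta_def in_eta_def map_poly_pCons distrib_right pCons_one)
  have X: "sop ?X v = D (Suc 0) v"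
    by (simp add: fun_eq_iff scalar_op_pCons scalar_op_zero)
  have "(bop p u v has_vector_derivative
      (\<Sum>k\<le>degree p. D k u z * D (Suc 0) (sop (coeff p k) v) z + D (Suc k) u z * sop (coeff p k) v z))
      (at z within {a..b})"
    unfolding bilinear_op_def[abs_def]
    using nth_deriv_has_vector_derivative[OF smooth_scalar_op[OF assms(2)] assms(3), of 0]
      nth_deriv_has_vector_derivative[OF assms(1,3)]
    by (intro has_vector_derivative_sum has_vector_derivative_mult) simp_all
  moreover have "bop (zeta_plus_eta * p) u v z
      = (\<Sum>k\<le>degree p. D k u z * D (Suc 0) (sop (coeff p k) v) z + D (Suc k) u z * sop (coeff p k) v z)"
    using assms
    by (simp add: zpe bilinear_op_add bilinear_op_smult bilinear_op_pCons scalar_op_zero X)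
      (simp add: bilinear_op_def nth_deriv_scalar_op nth_deriv_nth_deriv sum.distrib add.commute)
  ultimately show ?thesis by simp
qed

text \<open>The factorization is expanded back into \<Pi>, because the power balance is an identity
  about \<Pi>; the rest reorders finite sums.\<close>

lemma quad_boundary_op:
  assumes "smooth l1" "smooth l2" "z \<in> {a..b}"
  shows "quad n S (boundary_op {a..b} n Z l1 z) (boundary_op {a..b} n Z l2 z)
    = (\<Sum>i\<in>UNIV. \<Sum>j\<in>UNIV. bop (two_var_factor n Z S $ i $ j) (\<lambda>z. l1 z $ i) (\<lambda>z. l2 z $ j) z)"
proof -
  let ?x = "\<lambda>p i. sop (Z p $ i) (\<lambda>z. l1 z $ i) z" and ?y = "\<lambda>q j. sop (Z q $ j) (\<lambda>z. l2 z $ j) z"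
  have "bop (two_var_factor n Z S $ i $ j) (\<lambda>z. l1 z $ i) (\<lambda>z. l2 z $ j) z
      = (\<Sum>p<n. \<Sum>q<n. ?x p i * S p q * ?y q j)" for i j
  proof -
    have "in_zeta r * [:[:c:]:] * in_eta s = in_zeta r * in_eta (smult c s)" for r s c
      by (simp add: in_eta_def)
    then show ?thesis
      using smooth_component[OF assms(2)] assms(3)
      by (simp add: two_var_factor_def bilinear_op_sum bilinear_op_product scalar_op_smult mult.assoc)
  qed
  then have "(\<Sum>i\<in>UNIV. \<Sum>j\<in>UNIV. bop (two_var_factor n Z S $ i $ j) (\<lambda>z. l1 z $ i) (\<lambda>z. l2 z $ j) z)
      = (\<Sum>i\<in>UNIV. \<Sum>j\<in>UNIV. \<Sum>p<n. \<Sum>q<n. ?x p i * S p q * ?y q j)"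
    by simp
  also have "\<dots> = (\<Sum>i\<in>UNIV. \<Sum>p<n. \<Sum>j\<in>UNIV. \<Sum>q<n. ?x p i * S p q * ?y q j)"
    by (intro sum.cong refl) (rule sum.swap)
  also have "\<dots> = (\<Sum>p<n. \<Sum>i\<in>UNIV. \<Sum>j\<in>UNIV. \<Sum>q<n. ?x p i * S p q * ?y q j)"
    by (rule sum.swap)
  also have "\<dots> = (\<Sum>p<n. \<Sum>i\<in>UNIV. \<Sum>q<n. \<Sum>j\<in>UNIV. ?x p i * S p q * ?y q j)"
    by (intro sum.cong refl) (rule sum.swap)
  also have "\<dots> = (\<Sum>p<n. \<Sum>q<n. \<Sum>i\<in>UNIV. \<Sum>j\<in>UNIV. ?x p i * S p q * ?y q j)"
    by (intro sum.cong refl) (rule sum.swap)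
  also have "\<dots> = (\<Sum>p<n. \<Sum>q<n. \<Sum>j\<in>UNIV. \<Sum>i\<in>UNIV. ?x p i * S p q * ?y q j)"
    by (rule sum.cong[OF refl], rule sum.cong[OF refl], rule sum.swap)
  also have "\<dots> = (\<Sum>p<n. \<Sum>q<n. (\<Sum>i\<in>UNIV. ?x p i) * S p q * (\<Sum>j\<in>UNIV. ?y q j))"
    by (simp add: sum_distrib_left sum_distrib_right)
  also have "\<dots> = quad n S (boundary_op {a..b} n Z l1 z) (boundary_op {a..b} n Z l2 z)"
    using assms by (simp add: quad_def boundary_op_def row_op_eq)
  finally show ?thesis by simp
qed

lemma diff_op_component:
  assumes "smooth w" "z \<in> {a..b}"
  shows "diff_op {a..b} A w z $ i = (\<Sum>j\<in>UNIV. sop (A $ i $ j) (\<lambda>z. w z $ j) z)"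
  using assms by (simp add: diff_op_def row_op_eq)

text \<open>The power balance \<open>d/dz (b\<^sub>1\<^sup>T \<Sigma> b\<^sub>2) = e\<^sub>1\<^sup>T f\<^sub>2 + e\<^sub>2\<^sup>T f\<^sub>1\<close>, integrated over \<open>[a, b]\<close>.\<close>

lemma integral_power_balance:
  fixes F E :: "real poly^'m^'m"
  assumes fac: "pm_zeta F ** transpose (pm_eta E) + pm_zeta E ** transpose (pm_eta F)
           = (\<chi> i j. zeta_plus_eta * two_var_factor n Z S $ i $ j)"
    and l: "smooth l1" "smooth l2"
  shows "integral {a..b} (\<lambda>z.
        diff_op {a..b} (transpose E) l1 z \<bullet> diff_op {a..b} (transpose F) l2 z
      + diff_op {a..b} (transpose E) l2 z \<bullet> diff_op {a..b} (transpose F) l1 z)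
    = quad n S (boundary_op {a..b} n Z l1 b) (boundary_op {a..b} n Z l2 b)
      - quad n S (boundary_op {a..b} n Z l1 a) (boundary_op {a..b} n Z l2 a)"
proof -
  let ?P = "two_var_factor n Z S"
  let ?u = "\<lambda>i z. l1 z $ i" and ?v = "\<lambda>j z. l2 z $ j"
  let ?B = "\<lambda>z. \<Sum>i\<in>UNIV. \<Sum>j\<in>UNIV. bop (?P $ i $ j) (?u i) (?v j) z"
  have sm: "smooth (?u i)" "smooth (?v i)" for i
    using smooth_component l by blast+
  have "(?B has_vector_derivative (diff_op {a..b} (transpose E) l1 z \<bullet> diff_op {a..b} (transpose F) l2 z
      + diff_op {a..b} (transpose E) l2 z \<bullet> diff_op {a..b} (transpose F) l1 z)) (at z within {a..b})"
    if z: "z \<in> {a..b}" for z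
  proof -
    have entry: "zeta_plus_eta * ?P $ i $ j = (\<Sum>k\<in>UNIV. in_zeta (F $ i $ k) * in_eta (E $ j $ k))
        + (\<Sum>k\<in>UNIV. in_zeta (E $ i $ k) * in_eta (F $ j $ k))" for i j
      using arg_cong[OF fac, of "\<lambda>M. M $ i $ j"]
      by (simp add: matrix_matrix_mult_def transpose_def pm_zeta_def pm_eta_def)
    have swap: "(\<Sum>i\<in>UNIV. \<Sum>j\<in>UNIV. \<Sum>k\<in>UNIV. sop (G $ i $ k) (?u i) z * sop (H $ j $ k) (?v j) z)
        = diff_op {a..b} (transpose G) l1 z \<bullet> diff_op {a..b} (transpose H) l2 z"
      for G H :: "real poly^'m^'m"
    proof -
      have "(\<Sum>i\<in>UNIV. \<Sum>j\<in>UNIV. \<Sum>k\<in>UNIV. sop (G $ i $ k) (?u i) z * sop (H $ j $ k) (?v j) z)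
          = (\<Sum>i\<in>UNIV. \<Sum>k\<in>UNIV. \<Sum>j\<in>UNIV. sop (G $ i $ k) (?u i) z * sop (H $ j $ k) (?v j) z)"
        by (rule sum.cong[OF refl], rule sum.swap)
      also have "\<dots> = (\<Sum>k\<in>UNIV. \<Sum>i\<in>UNIV. \<Sum>j\<in>UNIV. sop (G $ i $ k) (?u i) z * sop (H $ j $ k) (?v j) z)"
        by (rule sum.swap)
      finally show ?thesis
        using l z by (simp add: inner_vec_def diff_op_component transpose_def sum_product)
    qed
    have "(?B has_vector_derivative (\<Sum>i\<in>UNIV. \<Sum>j\<in>UNIV. bop (zeta_plus_eta * ?P $ i $ j) (?u i) (?v j) z))
        (at z within {a..b})"
      using sm z by (intro has_vector_derivative_sum bilinear_op_has_derivative)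
    also have "(\<Sum>i\<in>UNIV. \<Sum>j\<in>UNIV. bop (zeta_plus_eta * ?P $ i $ j) (?u i) (?v j) z)
        = diff_op {a..b} (transpose F) l1 z \<bullet> diff_op {a..b} (transpose E) l2 z
        + diff_op {a..b} (transpose E) l1 z \<bullet> diff_op {a..b} (transpose F) l2 z"
      using sm z unfolding swap[symmetric]
      by (simp add: entry bilinear_op_add bilinear_op_sum bilinear_op_product sum.distrib)
    finally show ?thesis by (simp add: inner_commute add.commute)
  qed
  then have "((\<lambda>z. diff_op {a..b} (transpose E) l1 z \<bullet> diff_op {a..b} (transpose F) l2 z
      + diff_op {a..b} (transpose E) l2 z \<bullet> diff_op {a..b} (transpose F) l1 z)
      has_integral ?B b - ?B a) {a..b}"
    using ab by (intro fundamental_theorem_of_calculus) auto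
  then show ?thesis
    using ab l by (simp add: integral_unique quad_boundary_op)
qed

subsection \<open>Kernel and image representations\<close>

lemma smooth_diff_op:
  assumes "smooth w"
  shows "smooth (diff_op {a..b} A w)"
proof (rule smooth_cong)
  show "smooth (\<lambda>z. \<chi> i. \<Sum>j\<in>UNIV. sop (A $ i $ j) (\<lambda>z. w z $ j) z)"
    by (intro smooth_vec_lambda smooth_sum smooth_scalar_op
        smooth_component assms)
qed (simp add: vec_eq_iff diff_op_component[OF assms])

lemma smooth_latent_output: "smooth w \<Longrightarrow> smooth (latent_output {a..b} A w)"
  by (rule smooth_cong[OF smooth_diff_op]) (simp_all add: latent_output_def)

lemma smooth_vstack: "smooth f \<Longrightarrow> smooth e \<Longrightarrow> smooth (vstack f e j)"
  by (cases j) (simp_all add: smooth_component)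

lemma row_op_add:
  assumes "smooth u" "smooth v" "z \<in> {a..b}"
  shows "row_op {a..b} p (\<lambda>z. u z + v z) z = row_op {a..b} p u z + row_op {a..b} p v z"
  using assms by (simp add: row_op_def nth_deriv_add distrib_left sum.distrib)

lemma row_op_scaleR:
  assumes "smooth u" "z \<in> {a..b}"
  shows "row_op {a..b} p (\<lambda>z. c *\<^sub>R u z) z = c * row_op {a..b} p u z"
  using assms by (simp add: row_op_def nth_deriv_scaleR sum_distrib_left mult_ac)

lemma row_op_zero:
  assumes "z \<in> {a..b}"
  shows "row_op {a..b} p (\<lambda>z. 0) z = 0"
  using assms by (simp add: row_op_def nth_deriv_zero)

lemma kernel_operator:
  assumes "smooth f" "smooth e" "z \<in> {a..b}"
  shows "(diff_op {a..b} A f z + diff_op {a..b} B e z) $ i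
    = (\<Sum>j\<in>UNIV. sop (hblock A B $ i $ j) (vstack f e j) z)"
  using assms by (simp add: diff_op_component sum_UNIV_Plus hblock_def)

lemma image_operator:
  assumes "smooth l" "z \<in> {a..b}"
  shows "(\<Sum>k\<in>UNIV. sop (transpose (hblock F E) $ j $ k) (\<lambda>z. l z $ k) z)
    = vstack (diff_op {a..b} (transpose F) l) (diff_op {a..b} (transpose E) l) j z"
  using assms
  by (cases j) (simp_all add: diff_op_component transpose_def hblock_def)

lemma image_in_kernel:
  fixes A B F E :: "real poly^'m^'m"
  assumes RM: "hblock A B ** transpose (hblock F E) = 0"
    and l: "smooth l" and z: "z \<in> {a..b}"
    and "smooth f" "smooth e"
    and fe: "\<And>z. z \<in> {a..b} \<Longrightarrow> f z = diff_op {a..b} (transpose F) l z"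
      "\<And>z. z \<in> {a..b} \<Longrightarrow> e z = diff_op {a..b} (transpose E) l z"
  shows "diff_op {a..b} A f z + diff_op {a..b} B e z = 0"
proof -
  let ?M = "transpose (hblock F E)"
  have "(diff_op {a..b} A f z + diff_op {a..b} B e z) $ i = 0" for i
  proof -
    have "(diff_op {a..b} A f z + diff_op {a..b} B e z) $ i
        = (\<Sum>j\<in>UNIV. sop (hblock A B $ i $ j) (\<lambda>z. \<Sum>k\<in>UNIV. sop (?M $ j $ k) (\<lambda>z. l z $ k) z) z)"
      unfolding kernel_operator[OF assms(4,5) z]
    proof (intro sum.cong refl scalar_op_cong z)
      fix j y assume "y \<in> {a..b}"
      then show "vstack f e j y = (\<Sum>k\<in>UNIV. sop (?M $ j $ k) (\<lambda>z. l z $ k) y)"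
        using l by (cases j) (simp_all add: image_operator fe)
    qed
    also have "\<dots> = (\<Sum>k\<in>UNIV. sop ((hblock A B ** ?M) $ i $ k) (\<lambda>z. l z $ k) z)"
      using l z by (simp add: matrix_op_mult smooth_component)
    finally show ?thesis by (simp add: RM scalar_op_zero)
  qed
  then show ?thesis by (simp add: vec_eq_iff)
qed

text \<open>Apply the identity to the stacked signal \<open>vstack f e\<close>. The term through
  \<open>hblock A B\<close> vanishes by the equation, so the signal is the image of
  \<open>l\<close>, obtained by applying \<open>Y\<close> to it.\<close>

lemma kernel_in_image:
  fixes A B F E :: "real poly^'m^'m"
  assumes id: "X ** hblock A B + transpose (hblock F E) ** Y = mat 1"
    and fe: "smooth f" "smooth e"
    and ker: "\<And>z. z \<in> {a..b} \<Longrightarrow> diff_op {a..b} A f z + diff_op {a..b} B e z = 0"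
  obtains l where "smooth l"
    "\<And>z. z \<in> {a..b} \<Longrightarrow> f z = diff_op {a..b} (transpose F) l z"
    "\<And>z. z \<in> {a..b} \<Longrightarrow> e z = diff_op {a..b} (transpose E) l z"
proof -
  let ?R = "hblock A B" and ?M = "transpose (hblock F E)" and ?w = "vstack f e"
  have w: "smooth (?w j)" for j using fe by (rule smooth_vstack)
  define l where "l z = (\<chi> k. \<Sum>j\<in>UNIV. sop (Y $ k $ j) (?w j) z)" for z
  have l: "smooth l"
    unfolding l_def[abs_def]
    by (intro smooth_vec_lambda smooth_sum smooth_scalar_op w)
  have eq: "vstack f e i z = vstack (diff_op {a..b} (transpose F) l) (diff_op {a..b} (transpose E) l) i z"
    if z: "z \<in> {a..b}" for i z
  proof -
    have "?w i z = (\<Sum>j\<in>UNIV. sop ((mat 1 :: real poly^('m + 'm)^('m + 'm)) $ i $ j) (?w j) z)"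
      by (simp add: mat_def if_distrib[of "\<lambda>p. sop p u z" for u] scalar_op_one scalar_op_zero cong: if_cong)
    also have "\<dots> = (\<Sum>j\<in>UNIV. sop ((X ** ?R) $ i $ j) (?w j) z)
        + (\<Sum>j\<in>UNIV. sop ((?M ** Y) $ i $ j) (?w j) z)"
      by (simp add: scalar_op_add_poly sum.distrib flip: id)
    also have "(\<Sum>j\<in>UNIV. sop ((X ** ?R) $ i $ j) (?w j) z)
        = (\<Sum>k\<in>UNIV. sop (X $ i $ k) (\<lambda>z. \<Sum>j\<in>UNIV. sop (?R $ k $ j) (?w j) z) z)"
      using w z by (rule matrix_op_mult)
    also have "\<dots> = (\<Sum>k\<in>UNIV. sop (X $ i $ k) (\<lambda>z. 0) z)"
      using ker by (intro sum.cong refl scalar_op_cong z) (simp flip: kernel_operator[OF fe])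
    also have "\<dots> = 0"
      using z by (simp add: scalar_op_def nth_deriv_zero)
    also have "(\<Sum>j\<in>UNIV. sop ((?M ** Y) $ i $ j) (?w j) z)
        = (\<Sum>k\<in>UNIV. sop (?M $ i $ k) (\<lambda>z. l z $ k) z)"
      using w z by (simp add: matrix_op_mult l_def)
    finally show ?thesis using l z by (simp add: image_operator)
  qed
  show thesis
  proof (rule that[OF l])
    fix z assume z: "z \<in> {a..b}"
    show "f z = diff_op {a..b} (transpose F) l z" "e z = diff_op {a..b} (transpose E) l z"
      using eq[OF z, of "Inl i" for i] eq[OF z, of "Inr i" for i] by (simp_all add: vec_eq_iff)
  qed
qed

subsection \<open>Separation by test functions\<close>

lemma diff_op_adjoint:
  fixes A :: "real poly^'m^'m"
  assumes w: "smooth w" and l: "smooth l"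
    and N: "\<And>i j. degree (A $ i $ j) < N"
    and van: "\<And>k. k < N \<Longrightarrow> D k l a = 0" "\<And>k. k < N \<Longrightarrow> D k l b = 0"
  shows "integral {a..b} (\<lambda>z. w z \<bullet> diff_op {a..b} (transpose A) l z)
       = integral {a..b} (\<lambda>z. diff_op {a..b} (pm_reflect A) w z \<bullet> l z)"
proof -
  let ?w = "\<lambda>i z. w z $ i" and ?l = "\<lambda>j z. l z $ j"
  have sm: "smooth (?w i)" "smooth (?l i)" "smooth (sop p (?w i))" "smooth (sop p (?l i))" for i p
    by (intro smooth_scalar_op smooth_component w l)+
  note cont = sm[THEN smooth_continuous]
  have "integral {a..b} (\<lambda>z. w z \<bullet> diff_op {a..b} (transpose A) l z)
      = integral {a..b} (\<lambda>z. \<Sum>i\<in>UNIV. \<Sum>j\<in>UNIV. ?w i z * sop (A $ j $ i) (?l j) z)"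
    using l by (intro integral_cong) (simp add: inner_vec_def diff_op_component transpose_def sum_distrib_left)
  also have "\<dots> = (\<Sum>i\<in>UNIV. \<Sum>j\<in>UNIV. integral {a..b} (\<lambda>z. ?w i z * sop (A $ j $ i) (?l j) z))"
    by (subst integral_sum integral_sum,
        auto intro!: sum.cong integral_sum integrable_continuous_real continuous_intros cont)
  also have "\<dots> = (\<Sum>i\<in>UNIV. \<Sum>j\<in>UNIV. integral {a..b} (\<lambda>z. sop (pm_reflect A $ j $ i) (?w i) z * ?l j z))"
    unfolding pm_reflect_def vec_lambda_beta
    using van nth_deriv_component[OF l] ab
    by (intro sum.cong refl scalar_op_adjoint[OF sm(1,2) N]) auto
  also have "\<dots> = (\<Sum>j\<in>UNIV. \<Sum>i\<in>UNIV. integral {a..b} (\<lambda>z. sop (pm_reflect A $ j $ i) (?w i) z * ?l j z))"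
    by (rule sum.swap)
  also have "\<dots> = integral {a..b} (\<lambda>z. \<Sum>j\<in>UNIV. \<Sum>i\<in>UNIV. sop (pm_reflect A $ j $ i) (?w i) z * ?l j z)"
    by (subst integral_sum integral_sum,
        auto intro!: sum.cong integral_sum[symmetric] integrable_continuous_real continuous_intros cont)
  also have "\<dots> = integral {a..b} (\<lambda>z. diff_op {a..b} (pm_reflect A) w z \<bullet> l z)"
    using w by (intro integral_cong) (simp add: inner_vec_def diff_op_component sum_distrib_right)
  finally show ?thesis .
qed

text \<open>Testing \<open>g\<close> against \<open>((z - a) (z - b))\<^sup>2\<^sup>N g(z)\<close>, which vanishes to high order at both ends.\<close>

lemma fundamental_lemma:
  fixes g :: "real \<Rightarrow> real^'m"
  assumes g: "smooth g"
    and test: "\<And>l. smooth l \<Longrightarrow> (\<And>k. k < N \<Longrightarrow> D k l a = 0 \<and> D k l b = 0)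
      \<Longrightarrow> integral {a..b} (\<lambda>z. g z \<bullet> l z) = 0"
    and z: "z \<in> {a..b}"
  shows "g z = 0"
proof -
  \<comment> \<open>The exponent is even, so \<open>W\<close> is nonnegative, and large enough that
    all derivatives of order below \<open>N\<close> vanish at both ends.\<close>
  define W :: "real poly" where "W = ([:- a, 1:] * [:- b, 1:]) ^ (2 * N)"
  define l where "l z = (\<chi> j. poly W z * g z $ j)" for z
  have sm: "smooth (\<lambda>z. poly W z * g z $ j)" for j
    by (intro smooth_mult smooth_poly smooth_component g)
  then have l: "smooth l"
    unfolding l_def[abs_def] by (rule smooth_vec_lambda)
  have root: "poly ((pderiv ^^ k) W) c = 0" if "k < N" "c = a \<or> c = b" for k c
  proof -
    have Wa: "W = [:- a, 1:] ^ (2 * N) * [:- b, 1:] ^ (2 * N)"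
      by (simp only: W_def power_mult_distrib)
    have Wb: "W = [:- b, 1:] ^ (2 * N) * [:- a, 1:] ^ (2 * N)"
      by (simp only: W_def power_mult_distrib mult.commute)
    have "k \<le> 2 * N" "k \<noteq> 2 * N" using \<open>k < N\<close> by simp_all
    note root = poly_higher_pderiv_root[OF this(1), unfolded if_not_P[OF this(2)]]
    from \<open>c = a \<or> c = b\<close> show ?thesis
    proof
      assume "c = a"
      then show ?thesis using root[of a] by (simp only: Wa)
    next
      assume "c = b"
      then show ?thesis using root[of b] by (simp only: Wb)
    qed
  qed
  have "D k l c = 0" if "k < N" and c: "c = a \<or> c = b" for k c
  proof -
    have cI: "c \<in> {a..b}" using c ab by auto
    have "D k l c $ j = 0" for j
    proof -
      have "D k l c $ j = D k (\<lambda>z. poly W z * g z $ j) c"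
        using nth_deriv_component[OF l cI] by (simp add: l_def)
      also have "\<dots> = 0"
        using root[OF _ c] \<open>k < N\<close>
        by (simp add: nth_deriv_mult[OF smooth_poly smooth_component[OF g] cI]
            nth_deriv_poly[OF cI])
      finally show ?thesis .
    qed
    then show ?thesis by (simp add: vec_eq_iff)
  qed
  with l have "integral {a..b} (\<lambda>z. g z \<bullet> l z) = 0" by (intro test) auto
  moreover have "g z \<bullet> l z = poly W z * (g z \<bullet> g z)" for z
    by (simp add: l_def inner_vec_def sum_distrib_left mult_ac)
  ultimately have "integral {a..b} (\<lambda>z. poly W z * (g z \<bullet> g z)) = 0" by simp
  moreover have contg: "continuous_on {a..b} g" using g by (rule smooth_continuous)
  moreover have W: "poly W z = ((z - a) * (z - b)) ^ (2 * N)" for z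
    by (simp only: W_def poly_power poly_mult poly_pCons poly_0) simp
  ultimately have "\<forall>z\<in>{a..b}. poly W z * (g z \<bullet> g z) = 0"
    using ab by (subst integral_eq_0_iff[symmetric]) (auto intro!: continuous_intros zero_le_even_power)
  then have interior: "g z = 0" if "z \<in> {a<..<b}" for z
    using that by (auto simp: W)
  \<comment> \<open>The weight has its zeros at the endpoints, so \<open>g\<close> is reached there
    by continuity.\<close>
  show ?thesis
    by (rule continuous_constant_on_closure[of "{a<..<b}" g 0])
      (use ab z contg interior in \<open>auto simp: closure_greaterThanLessThan\<close>)
qed

text \<open>One test polynomial suffices. Its zero at \<open>y\<close> has order
  \<open>Suc (degree B)\<close> and kills every term of \<open>B\<close>, including the top one; its
  zero at \<open>x\<close> has order exactly \<open>degree A\<close> and leaves only the leading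
  coefficient of \<open>A\<close>.\<close>

lemma jets_separate:
  assumes x: "x \<in> {a..b}" and y: "y \<in> {a..b}" and "x \<noteq> y"
    and eq: "\<And>p. sop A (poly p) x = sop B (poly p) y"
  shows "A = 0"
proof -
  let ?p = "[:- x, 1:] ^ degree A * [:- y, 1:] ^ Suc (degree B)"
  have "sop B (poly ?p) y = 0"
    using poly_higher_pderiv_root[of _ "Suc (degree B)" y "[:- x, 1:] ^ degree A"]
    by (simp add: scalar_op_def nth_deriv_poly[OF y] mult.commute[of "[:- x, 1:] ^ degree A"]
        del: power_Suc)
  moreover have "sop A (poly ?p) x = (\<Sum>k\<le>degree A. if k = degree A
      then coeff A k * (fact (degree A) * (x - y) ^ Suc (degree B)) else 0)"
    unfolding scalar_op_def nth_deriv_poly[OF x]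
    by (intro sum.cong refl) (simp add: poly_higher_pderiv_root del: power_Suc)
  ultimately have "lead_coeff A * (fact (degree A) * (x - y) ^ Suc (degree B)) = 0"
    by (simp add: eq del: power_Suc)
  then show ?thesis using \<open>x \<noteq> y\<close> by auto
qed

subsection \<open>The boundary system\<close>

text \<open>For a polynomial latent variable in component \<open>j\<close> alone, each side becomes
  the scalar operator \<open>A x j\<close> or \<open>A y j\<close> evaluated at its own endpoint.
  Distinct endpoints force both to vanish, independence of the rows of \<open>Z\<close> gives
  \<open>c x = 0\<close> and \<open>c y = 0\<close> below \<open>n\<close>, and the inverse of
  \<open>S\<close> recovers \<open>x\<close> and \<open>y\<close>.\<close>

lemma boundary_values_separate:
  fixes Z :: "nat \<Rightarrow> real poly^'m"
  assumes min: "n = coeff_rank (two_var_factor n Z S)" and S: "sym_invertible n S"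
    and eq: "\<And>l. smooth l \<Longrightarrow>
      quad n S x (boundary_op {a..b} n Z l b) = quad n S y (boundary_op {a..b} n Z l a)"
    and r: "r < n"
  shows "x r = 0" "y r = 0"
proof -
  define c where "c u q = (\<Sum>p<n. u p * S p q)" for u q
  have quad: "quad n S u v = (\<Sum>q<n. c u q * v q)" for u v
    unfolding quad_def c_def by (subst sum.swap) (simp add: sum_distrib_right)
  define A where "A u j = (\<Sum>q<n. smult (c u q) (Z q $ j))" for u j
  have eq': "sop (A x j) (poly p) b = sop (A y j) (poly p) a" for j p
  proof -
    define l where "l z = (\<chi> i. if i = j then poly p z else 0)" for z
    have comp: "(\<lambda>z. l z $ i) = (if i = j then poly p else (\<lambda>z. 0))" for i
      by (simp add: l_def fun_eq_iff)
    have l: "smooth l"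
      unfolding l_def[abs_def]
    proof (rule smooth_vec_lambda)
      show "smooth (\<lambda>z. if i = j then poly p z else 0)" for i
        by (cases "i = j") (simp_all add: smooth_poly smooth_zero)
    qed
    have "row_op {a..b} (Z q) l z = sop (Z q $ j) (poly p) z" if z: "z \<in> {a..b}" for q z
    proof -
      have "sop s (\<lambda>z. 0) z = 0" for s
        using z by (simp add: scalar_op_def nth_deriv_zero)
      then show ?thesis
        by (simp add: row_op_eq[OF l z] comp if_distrib[of "\<lambda>u. sop s u z" for s] cong: if_cong)
    qed
    then have "quad n S u (boundary_op {a..b} n Z l z) = sop (A u j) (poly p) z"
      if "z \<in> {a..b}" for u z
      using that by (simp add: quad boundary_op_def A_def scalar_op_sum_poly scalar_op_smult)
    then show ?thesis using eq[OF l] ab by simp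
  qed
  have "A x j = 0" for j
    using ab eq' by (intro jets_separate[of b a]) auto
  then have cx: "c x q = 0" if "q < n" for q
    using minimal_factor_rows_independent[OF min, of "c x"] that by (simp add: A_def)
  have "A y j = 0" for j
    using ab eq'[symmetric] by (intro jets_separate[of a b]) auto
  then have cy: "c y q = 0" if "q < n" for q
    using minimal_factor_rows_independent[OF min, of "c y"] that by (simp add: A_def)
  obtain T where T: "\<And>p q. p < n \<Longrightarrow> q < n \<Longrightarrow> (\<Sum>r<n. S p r * T r q) = (if p = q then 1 else 0)"
    using S unfolding sym_invertible_def by blast
  have "(\<Sum>q<n. c u q * T q r) = u r" for u
  proof -
    have "(\<Sum>q<n. c u q * T q r) = (\<Sum>p<n. u p * (\<Sum>q<n. S p q * T q r))"
      unfolding c_def sum_distrib_right sum_distrib_left by (subst sum.swap) (simp add: mult.assoc)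
    also have "\<dots> = u r"
      using r by (simp add: T if_distrib cong: if_cong)
    finally show ?thesis .
  qed
  from this[of x] this[of y] show "x r = 0" "y r = 0"
    by (simp_all add: cx cy)
qed

text \<open>Extension by zero turns agreement on the interval into equality of functions, and
  \<open>image_in_kernel\<close> supplies the differential equation for every
  \<open>l\<close>.\<close>

lemma boundary_system_iff:
  assumes RM: "hblock (pm_reflect E) (pm_reflect F) ** transpose (hblock F E) = 0"
  shows "(f, e, x, y) \<in> boundary_system F E n Z a b \<longleftrightarrow>
    (\<exists>l. smooth l \<and> f = latent_output {a..b} F l \<and> e = latent_output {a..b} E l \<and>
      x = boundary_op {a..b} n Z l a \<and> y = boundary_op {a..b} n Z l b)" (is "?L \<longleftrightarrow> ?R")
proof
  assume ?L
  then obtain l where "smooth l" "x = boundary_op {a..b} n Z l a" "y = boundary_op {a..b} n Z l b"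
    and fe: "\<And>z. z \<in> {a..b} \<Longrightarrow> f z = diff_op {a..b} (transpose F) l z \<and> e z = diff_op {a..b} (transpose E) l z"
      "\<And>z. z \<notin> {a..b} \<Longrightarrow> f z = 0 \<and> e z = 0"
    by (auto simp: boundary_system_def ext_space_def)
  moreover have "f = latent_output {a..b} F l" "e = latent_output {a..b} E l"
    using fe by (simp_all add: fun_eq_iff latent_output_def del: atLeastAtMost_iff)
  ultimately show ?R by blast
next
  assume ?R
  then obtain l where l: "smooth l" "f = latent_output {a..b} F l" "e = latent_output {a..b} E l"
      "x = boundary_op {a..b} n Z l a" "y = boundary_op {a..b} n Z l b"
    by blast
  have sm: "smooth f" "smooth e" using l by (simp_all add: smooth_latent_output)
  have fe: "f z = diff_op {a..b} (transpose F) l z" "e z = diff_op {a..b} (transpose E) l z"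
    if "z \<in> {a..b}" for z
    using that by (simp_all add: l latent_output_def)
  have "diff_op {a..b} (pm_reflect E) f z + diff_op {a..b} (pm_reflect F) e z = 0" if "z \<in> {a..b}" for z
    using RM l(1) that sm fe by (rule image_in_kernel)
  moreover have "(f, e, x, y) \<in> ext_space a b n"
    using sm by (auto simp: ext_space_def boundary_op_def l latent_output_def)
  ultimately show ?L
    using l(1,4,5) fe unfolding boundary_system_def by blast
qed

lemma boundary_system_subspace:
  fixes F E :: "real poly^'m^'m"
  assumes RM: "hblock (pm_reflect E) (pm_reflect F) ** transpose (hblock F E) = 0"
  shows "module.subspace ext_scale (boundary_system F E n Z a b)"
proof -
  interpret V: vector_space "ext_scale :: real \<Rightarrow> 'm ext_var \<Rightarrow> _" by (rule vector_space_ext_scale)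
  have I: "a \<in> {a..b}" "b \<in> {a..b}" using ab by auto
  have "(\<lambda>z. 0, \<lambda>z. 0, \<lambda>z. 0, \<lambda>z. 0) \<in> boundary_system F E n Z a b"
    unfolding boundary_system_iff[OF RM] using I
    by (intro exI[of _ "\<lambda>z. 0"])
      (auto simp: smooth_zero latent_output_def diff_op_def row_op_zero boundary_op_def fun_eq_iff vec_eq_iff)
  then have "0 \<in> boundary_system F E n Z a b"
    by (simp add: zero_prod_def zero_fun_def)
  moreover have "v + w \<in> boundary_system F E n Z a b"
    if vw: "v \<in> boundary_system F E n Z a b" "w \<in> boundary_system F E n Z a b" for v w
  proof -
    obtain f e x y f' e' x' y' where v: "v = (f, e, x, y)" and w: "w = (f', e', x', y')"
      by (metis prod_cases4)
    obtain l l' where l: "smooth l" "f = latent_output {a..b} F l" "e = latent_output {a..b} E l"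
        "x = boundary_op {a..b} n Z l a" "y = boundary_op {a..b} n Z l b"
      and l': "smooth l'" "f' = latent_output {a..b} F l'" "e' = latent_output {a..b} E l'"
        "x' = boundary_op {a..b} n Z l' a" "y' = boundary_op {a..b} n Z l' b"
      using vw unfolding v w boundary_system_iff[OF RM] by blast
    have "(f + f', e + e', x + x', y + y') \<in> boundary_system F E n Z a b"
      unfolding boundary_system_iff[OF RM] using I l l'
      by (intro exI[of _ "\<lambda>z. l z + l' z"])
        (auto simp: smooth_add latent_output_def diff_op_def row_op_add boundary_op_def fun_eq_iff vec_eq_iff)
    then show ?thesis by (simp add: v w)
  qed
  moreover have "ext_scale c v \<in> boundary_system F E n Z a b"
    if v': "v \<in> boundary_system F E n Z a b" for c v
  proof -
    obtain f e x y where v: "v = (f, e, x, y)" by (metis prod_cases4)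
    obtain l where l: "smooth l" "f = latent_output {a..b} F l" "e = latent_output {a..b} E l"
        "x = boundary_op {a..b} n Z l a" "y = boundary_op {a..b} n Z l b"
      using v' unfolding v boundary_system_iff[OF RM] by blast
    have "(fun_scale c f, fun_scale c e, fun_scale c x, fun_scale c y) \<in> boundary_system F E n Z a b"
      unfolding boundary_system_iff[OF RM] using I l
      by (intro exI[of _ "\<lambda>z. c *\<^sub>R l z"])
        (auto simp: smooth_scaleR latent_output_def diff_op_def row_op_scaleR boundary_op_def
          fun_scale_def fun_eq_iff vec_eq_iff)
    then show ?thesis by (simp add: v ext_scale_def)
  qed
  ultimately show ?thesis unfolding V.subspace_def by blast
qed

text \<open>Since \<open>f\<close> and \<open>e\<close> are prescribed only on the interval, this
  applies to generated elements and also to an orthogonal \<open>(f, e)\<close> paired with the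
  boundary values of \<open>l\<close> in place of its own.\<close>

lemma boundary_system_isotropic:
  fixes F E :: "real poly^'m^'m"
  assumes fac: "pm_zeta F ** transpose (pm_eta E) + pm_zeta E ** transpose (pm_eta F)
           = (\<chi> i j. zeta_plus_eta * two_var_factor n Z S $ i $ j)"
    and l: "smooth l" "smooth l'"
    and fe: "\<And>z. z \<in> {a..b} \<Longrightarrow> f z = diff_op {a..b} (transpose F) l z"
      "\<And>z. z \<in> {a..b} \<Longrightarrow> e z = diff_op {a..b} (transpose E) l z"
  shows "ext_form a b n S
      (f, e, boundary_op {a..b} n Z l a, boundary_op {a..b} n Z l b)
      (latent_output {a..b} F l', latent_output {a..b} E l',
       boundary_op {a..b} n Z l' a, boundary_op {a..b} n Z l' b) = 0"
proof -
  have "integral {a..b} (\<lambda>z. e z \<bullet> diff_op {a..b} (transpose F) l' z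
        + diff_op {a..b} (transpose E) l' z \<bullet> f z)
      = integral {a..b} (\<lambda>z. diff_op {a..b} (transpose E) l z \<bullet> diff_op {a..b} (transpose F) l' z
        + diff_op {a..b} (transpose E) l' z \<bullet> diff_op {a..b} (transpose F) l z)"
    using fe by (intro integral_cong) simp
  then show ?thesis
    by (simp add: ext_form_latent_output integral_power_balance[OF fac l])
qed

lemma orthogonal_in_kernel:
  fixes F E :: "real poly^'m^'m"
  assumes fe: "smooth f" "smooth e"
    and orth: "\<And>l. smooth l \<Longrightarrow> ext_form a b n S (f, e, x, y)
      (latent_output {a..b} F l, latent_output {a..b} E l,
       boundary_op {a..b} n Z l a, boundary_op {a..b} n Z l b) = 0"
    and z: "z \<in> {a..b}"
  shows "diff_op {a..b} (pm_reflect E) f z + diff_op {a..b} (pm_reflect F) e z = 0"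
proof -
  let ?deg = "\<lambda>A :: real poly^'m^'m. \<Sum>i\<in>UNIV. \<Sum>j\<in>UNIV. degree (A $ i $ j)"
  let ?degZ = "\<Sum>p<n. \<Sum>j\<in>UNIV. degree (Z p $ j)"
  \<comment> \<open>The order exceeds every degree in \<open>F\<close>, \<open>E\<close> and
    \<open>Z\<close>, so a latent variable flat to this order has zero boundary values and
    integrates by parts without boundary terms.\<close>
  define N where "N = Suc (?deg F + ?deg E + ?degZ)"
  have deg: "degree (A $ i $ j) \<le> ?deg A" for A :: "real poly^'m^'m" and i j
  proof -
    have "degree (A $ i $ j) \<le> (\<Sum>j\<in>UNIV. degree (A $ i $ j))"
      by (rule member_le_sum) auto
    also have "\<dots> \<le> ?deg A"
      by (rule member_le_sum[where f = "\<lambda>i. \<Sum>j\<in>UNIV. degree (A $ i $ j)"]) auto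
    finally show ?thesis .
  qed
  have degZ: "degree (Z p $ j) < N" if "p < n" for p j
  proof -
    have "degree (Z p $ j) \<le> (\<Sum>j\<in>UNIV. degree (Z p $ j))"
      by (rule member_le_sum) auto
    also have "\<dots> \<le> ?degZ"
      using that by (intro member_le_sum[where f = "\<lambda>p. \<Sum>j\<in>UNIV. degree (Z p $ j)"]) auto
    finally show ?thesis by (simp add: N_def)
  qed
  have degFE: "degree (F $ i $ j) < N" "degree (E $ i $ j) < N" for i j
    using deg[of F i j] deg[of E i j] by (simp_all add: N_def)
  show ?thesis
  proof (rule fundamental_lemma[OF _ _ z, where N = N])
    show "smooth (\<lambda>z. diff_op {a..b} (pm_reflect E) f z + diff_op {a..b} (pm_reflect F) e z)"
      using fe by (intro smooth_add smooth_diff_op)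
  next
    fix l :: "real \<Rightarrow> real^'m"
    assume l: "smooth l" and van: "\<And>k. k < N \<Longrightarrow> D k l a = 0 \<and> D k l b = 0"
    note sm = fe l smooth_diff_op[OF fe(1)] smooth_diff_op[OF fe(2)] smooth_diff_op[OF l]
    note cont = sm[THEN smooth_continuous]
    have "row_op {a..b} (Z p) l c = 0" if "p < n" "c = a \<or> c = b" for p c
    proof -
      have "D k l c = 0" if "k \<le> degree (Z p $ j)" for k j
        using that \<open>c = a \<or> c = b\<close> van[of k] degZ[OF \<open>p < n\<close>, of j] by auto
      then show ?thesis by (simp add: row_op_def)
    qed
    then have "boundary_op {a..b} n Z l a = (\<lambda>p. 0)" "boundary_op {a..b} n Z l b = (\<lambda>p. 0)"
      by (auto simp: boundary_op_def)
    then have "0 = integral {a..b} (\<lambda>z. e z \<bullet> diff_op {a..b} (transpose F) l z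
        + f z \<bullet> diff_op {a..b} (transpose E) l z)"
      using orth[OF l] by (simp add: ext_form_latent_output quad_def inner_commute)
    also have "\<dots> = integral {a..b} (\<lambda>z. e z \<bullet> diff_op {a..b} (transpose F) l z)
        + integral {a..b} (\<lambda>z. f z \<bullet> diff_op {a..b} (transpose E) l z)"
      by (intro integral_add integrable_continuous_real continuous_intros cont)
    also have "\<dots> = integral {a..b} (\<lambda>z. diff_op {a..b} (pm_reflect F) e z \<bullet> l z)
        + integral {a..b} (\<lambda>z. diff_op {a..b} (pm_reflect E) f z \<bullet> l z)"
      using van by (simp add: diff_op_adjoint[OF fe(1) l degFE(2)] diff_op_adjoint[OF fe(2) l degFE(1)])
    also have "\<dots> = integral {a..b} (\<lambda>z. diff_op {a..b} (pm_reflect F) e z \<bullet> l z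
        + diff_op {a..b} (pm_reflect E) f z \<bullet> l z)"
      by (intro integral_add[symmetric] integrable_continuous_real continuous_intros cont)
    finally show "integral {a..b} (\<lambda>z. (diff_op {a..b} (pm_reflect E) f z
        + diff_op {a..b} (pm_reflect F) e z) \<bullet> l z) = 0"
      by (simp add: inner_add_left add.commute)
  qed
qed

end

section \<open>The Dirac property\<close>

theorem proposition3:
  fixes F E :: "real poly^'m^'m"
    and P :: "real poly poly^'m^'m"
    and n :: nat
    and Z :: "nat \<Rightarrow> real poly^'m"
    and S :: "nat \<Rightarrow> nat \<Rightarrow> real"
    and \<alpha> \<beta> :: real
  assumes "\<And>s::complex. pm_eval F (- s) ** transpose (pm_eval E s)
             + pm_eval E (- s) ** transpose (pm_eval F s) = 0"
    and "\<And>s::complex. rank (hblock (pm_eval F (- s)) (pm_eval E (- s))) = CARD('m)"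
    and "pm_zeta F ** transpose (pm_eta E) + pm_zeta E ** transpose (pm_eta F)
           = (\<chi> i j. zeta_plus_eta * P $ i $ j)"
    and "P = two_var_factor n Z S"
    and "sym_invertible n S"
    and "n = coeff_rank P"
    and "\<alpha> < \<beta>"
  shows "dirac_structure ext_scale (ext_space \<alpha> \<beta> n) (ext_form \<alpha> \<beta> n S)
           (boundary_system F E n Z \<alpha> \<beta>)"
proof -
  let ?I = "{\<alpha>..\<beta>}" and ?D = "boundary_system F E n Z \<alpha> \<beta>"
  note fac = assms(3)[unfolded assms(4)] and min = assms(6)[unfolded assms(4)] and ab = \<open>\<alpha> < \<beta>\<close>
  let ?gen = "\<lambda>l. (latent_output ?I F l, latent_output ?I E l, boundary_op ?I n Z l \<alpha>, boundary_op ?I n Z l \<beta>)"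
  obtain X Y where RM: "hblock (pm_reflect E) (pm_reflect F) ** transpose (hblock F E) = 0"
    and id: "X ** hblock (pm_reflect E) (pm_reflect F) + transpose (hblock F E) ** Y = mat 1"
    using kernel_image_identity[OF assms(1,2)] by blast
  have D: "?D = ?gen ` {l. smooth_within ?I l}"
    using boundary_system_iff[OF ab RM, of _ _ _ _ n Z] by (auto simp: image_iff)
  have DV: "?D \<subseteq> ext_space \<alpha> \<beta> n" by (auto simp: boundary_system_def)
  have "?D \<subseteq> orth_companion (ext_space \<alpha> \<beta> n) (ext_form \<alpha> \<beta> n S) ?D"
  proof
    fix v assume v: "v \<in> ?D"
    then obtain l where l: "smooth_within ?I l" "v = ?gen l" unfolding D by blast
    have "ext_form \<alpha> \<beta> n S (?gen l) (?gen l') = 0" if "smooth_within ?I l'" for l'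
      by (rule boundary_system_isotropic[OF ab fac l(1) that]) (simp_all add: latent_output_def)
    then show "v \<in> orth_companion (ext_space \<alpha> \<beta> n) (ext_form \<alpha> \<beta> n S) ?D"
      using v DV unfolding orth_companion_def l(2) by (auto simp: D)
  qed
  moreover have "v \<in> ?D" if v: "v \<in> orth_companion (ext_space \<alpha> \<beta> n) (ext_form \<alpha> \<beta> n S) ?D" for v
  proof -
    obtain f e x y where v_eq: "v = (f, e, x, y)" by (metis prod_cases4)
    have fe: "smooth_within ?I f" "smooth_within ?I e"
      and supp: "\<And>z. z \<notin> ?I \<Longrightarrow> f z = 0 \<and> e z = 0" "\<And>p. n \<le> p \<Longrightarrow> x p = 0 \<and> y p = 0"
      using v unfolding v_eq orth_companion_def ext_space_def by auto
    have orth: "ext_form \<alpha> \<beta> n S (f, e, x, y) (?gen l) = 0" if "smooth_within ?I l" for l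
      using v that unfolding v_eq orth_companion_def D by blast
    obtain l where l: "smooth_within ?I l"
      and f: "\<And>z. z \<in> ?I \<Longrightarrow> f z = diff_op ?I (transpose F) l z"
      and e: "\<And>z. z \<in> ?I \<Longrightarrow> e z = diff_op ?I (transpose E) l z"
      using kernel_in_image[OF ab id fe orthogonal_in_kernel[OF ab fe orth]] by blast
    let ?x = "boundary_op ?I n Z l \<alpha>" and ?y = "boundary_op ?I n Z l \<beta>"
    \<comment> \<open>Both \<open>(f, e, x, y)\<close> and \<open>(f, e, ?x, ?y)\<close> annihilate
      the element generated by \<open>l'\<close>. Their integrals coincide, so only the differences
      of boundary values remain.\<close>
    have "quad n S (\<lambda>p. y p - ?y p) (boundary_op ?I n Z l' \<beta>) = quad n S (\<lambda>p. x p - ?x p) (boundary_op ?I n Z l' \<alpha>)"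
      if l': "smooth_within ?I l'" for l'
    proof -
      have diff: "quad n S (\<lambda>p. u p - u' p) w = quad n S u w - quad n S u' w" for u u' w
        by (simp add: quad_def left_diff_distrib sum_subtractf)
      show ?thesis
        using orth[OF l'] boundary_system_isotropic[OF ab fac l l' f e]
        by (simp add: ext_form_latent_output diff)
    qed
    then have "y p - ?y p = 0" "x p - ?x p = 0" if "p < n" for p
      using boundary_values_separate[OF ab min assms(5), of "\<lambda>p. y p - ?y p" "\<lambda>p. x p - ?x p"] that
      by blast+
    \<comment> \<open>From index \<open>n\<close> on, both sides are zero: by
      \<open>ext_space\<close> on the left and by the default value of \<open>boundary_op\<close> on
      the right.\<close>
    then have "y = ?y" "x = ?x"
      using supp(2) by (auto simp: fun_eq_iff boundary_op_def not_less)
    moreover have "f = latent_output ?I F l" "e = latent_output ?I E l"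
      using f e supp(1) by (auto simp: fun_eq_iff latent_output_def simp del: atLeastAtMost_iff)
    ultimately show ?thesis using l unfolding v_eq D by blast
  qed
  ultimately show ?thesis
    unfolding dirac_structure_def using DV boundary_system_subspace[OF ab RM] by blast
qed

end
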